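(* Let $K$ be a field and let $G$ be a cycle of length at most $7$. Then the cut ideal $I_G$ has a lexicographic quadratic Gröbner basis, i.e. there is a lexicographic order with respect to which $I_G$ has a Gröbner basis consisting of quadratic binomials.
   Context: Toric ideals: a $d\times n$ integer matrix $A=(\mathbf a_1,\dots,\mathbf a_n)$ with columns $\mathbf a_i$ is a configuration if there is $\mathbf c\in\mathbb R^d$ with $\mathbf a_i\cdot\mathbf c=1$ for all $i$. For a field $K$, the toric ideal $I_A$ is the kernel of the $K$-algebra homomorphism $K[x_1,\dots,x_n]\to K[t_1^{\pm1},\dots,t_d^{\pm1}]$, $x_i\mapsto \mathbf t^{\mathbf a_i}=t_1^{a_{1i}}\cdots t_d^{a_{di}}$. Cut ideals: let $G$ be a finite connected simple graph with vertex set $V(G)=\{1,\dots,m\}$ and edge set $E(G)=\{e_1,\dots,e_r\}$. For $C\subset V(G)$ let $\delta_C=(d_1,\dots,d_r)\in\{0,1\}^r$, where $d_i=1$ if $|C\cap e_i|=1$ and $d_i=0$ otherwise. Let $\delta_{C_1},\dots,\delta_{C_N}$, $N=2^{m-1}$, be the distinct elements of $\{\delta_C \mid C\subset V(G)\}$. Let $A_G$ be the $(r+1)\times N$ matrix whose $j$-th column is $\delta_{C_j}$ followed by an additional last entry $1$. The cut ideal $I_G\subset K[x_1,\dots,x_N]$ is the toric ideal of $A_G$. A cycle of length $n$ ($n\ge 3$, since graphs are simple) is the cycle graph with $n$ vertices and $n$ edges. A lexicographic order is the lexicographic monomial order induced by some total ordering of the variables. The zero ideal is regarded as having the empty set as a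 quadratic Gröbner basis. *)

theory Defs
  imports "HOL-Library.Poly_Mapping" "Jordan_Normal_Form.Matrix"
begin

section \<open>Polynomials and toric ideals\<close>

text \<open>
  A monomial is its finitely supported exponent vector, a polynomial a finitely supported
  coefficient function on monomials; multiplication is the convolution product of
  \<^theory>\<open>HOL-Library.Poly_Mapping\<close>. Variables are numbered from \<open>0\<close>, so
  \<open>x\<^sub>1, \<dots>, x\<^sub>n\<close> become the variables \<open>0, \<dots>, n - 1\<close>.
\<close>

type_synonym monomial = "nat \<Rightarrow>\<^sub>0 nat"
type_synonym 'k mpoly = "monomial \<Rightarrow>\<^sub>0 'k"
type_synonym 'k laurent = "(nat \<Rightarrow>\<^sub>0 int) \<Rightarrow>\<^sub>0 'k"

definition polys :: "nat \<Rightarrow> 'k::field mpoly set" where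
  "polys n = {p. \<forall>u \<in> Poly_Mapping.keys p. Poly_Mapping.keys u \<subseteq> {..<n}}"

text \<open>The Laurent monomial whose exponent vector is column \<open>j\<close> of \<open>A\<close>.\<close>

definition column_monomial :: "int mat \<Rightarrow> nat \<Rightarrow> 'k::field laurent" where
  "column_monomial A j =
     Poly_Mapping.single (\<Sum>i<dim_row A. Poly_Mapping.single i (A $$ (i, j))) 1"

text \<open>Evaluation of a polynomial at \<open>x\<^sub>j = column_monomial A j\<close>; \<open>single 0 c\<close> is the constant \<open>c\<close>.\<close>

definition toric_hom :: "int mat \<Rightarrow> 'k::field mpoly \<Rightarrow> 'k laurent" where
  "toric_hom A p =
     (\<Sum>u \<in> Poly_Mapping.keys p. Poly_Mapping.single 0 (Poly_Mapping.lookup p u) *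
        (\<Prod>j \<in> Poly_Mapping.keys u. column_monomial A j ^ Poly_Mapping.lookup u j))"

definition toric_ideal :: "int mat \<Rightarrow> 'k::field mpoly set" where
  "toric_ideal A = {p \<in> polys (dim_col A). toric_hom A p = 0}"

section \<open>Lexicographic Groebner bases\<close>

text \<open>
  A total ordering of the variables is a reflexive linear order \<open>r\<close> on \<open>{..<n}\<close>, where
  \<open>(i, j) \<in> r\<close> means \<open>x\<^sub>i \<le> x\<^sub>j\<close>. Then \<open>u\<close> is lexicographically smaller than \<open>v\<close> iff \<open>u\<close> has the
  smaller exponent at the largest variable in which the two differ.
\<close>

definition lex_less :: "nat rel \<Rightarrow> monomial \<Rightarrow> monomial \<Rightarrow> bool" where
  "lex_less r u v \<longleftrightarrow>
     (\<exists>i. Poly_Mapping.lookup u i < Poly_Mapping.lookup v i \<and> (\<forall>j. j \<noteq> i \<and> (i, j) \<in> r \<longrightarrow> Poly_Mapping.lookup u j = Poly_Mapping.lookup v j))"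

definition initial_monomial :: "nat rel \<Rightarrow> 'k::field mpoly \<Rightarrow> monomial" where
  "initial_monomial r p = (THE u. u \<in> Poly_Mapping.keys p \<and> (\<forall>v \<in> Poly_Mapping.keys p. v \<noteq> u \<longrightarrow> lex_less r v u))"

definition generated_ideal :: "nat \<Rightarrow> 'k::field mpoly set \<Rightarrow> 'k mpoly set" where
  "generated_ideal n S =
     {(\<Sum>s \<in> F. q s * s) | F q. finite F \<and> F \<subseteq> S \<and> (\<forall>s \<in> F. q s \<in> polys n)}"

definition initial_ideal :: "nat \<Rightarrow> nat rel \<Rightarrow> 'k::field mpoly set \<Rightarrow> 'k mpoly set" where
  "initial_ideal n r I =
     generated_ideal n {Poly_Mapping.single (initial_monomial r f) 1 | f. f \<in> I \<and> f \<noteq> 0}"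

text \<open>The empty set is a Groebner basis of the zero ideal.\<close>

definition lex_groebner_basis ::
  "nat \<Rightarrow> nat rel \<Rightarrow> 'k::field mpoly set \<Rightarrow> 'k mpoly set \<Rightarrow> bool" where
  "lex_groebner_basis n r I B \<longleftrightarrow>
     finite B \<and> B \<subseteq> I \<and> 0 \<notin> B \<and>
     generated_ideal n {Poly_Mapping.single (initial_monomial r g) 1 | g. g \<in> B}
       = initial_ideal n r I"

definition monomial_degree :: "monomial \<Rightarrow> nat" where
  "monomial_degree u = (\<Sum>i \<in> Poly_Mapping.keys u. Poly_Mapping.lookup u i)"

definition quadratic_binomial :: "'k::field mpoly \<Rightarrow> bool" where
  "quadratic_binomial f \<longleftrightarrow>
     (\<exists>u v. u \<noteq> v \<and> monomial_degree u = 2 \<and> monomial_degree v = 2 \<and>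
        f = Poly_Mapping.single u 1 - Poly_Mapping.single v 1)"

section \<open>Cut ideals\<close>

text \<open>
  A graph on the vertex set \<open>{1..m}\<close> is given by its set \<open>E\<close> of edges, which are two-element
  sets of vertices.
\<close>

definition is_cycle :: "nat \<Rightarrow> nat set set \<Rightarrow> bool" where
  "is_cycle m E \<longleftrightarrow>
     3 \<le> m \<and>
     (\<exists>f. bij_betw f {..<m} {1..m} \<and> E = {{f i, f (Suc i mod m)} | i. i < m})"

definition cut_vector :: "nat set list \<Rightarrow> nat set \<Rightarrow> int vec" where
  "cut_vector es C = vec (length es) (\<lambda>i. if card (C \<inter> es ! i) = 1 then 1 else 0)"

text \<open>
  The list \<open>es\<close> enumerates the edges and \<open>ds\<close> the distinct cut vectors; both enumerations are
  arbitrary. For a connected graph, \<open>length ds = 2 ^ (m - 1)\<close>.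
\<close>

definition edge_enumeration :: "nat set set \<Rightarrow> nat set list \<Rightarrow> bool" where
  "edge_enumeration E es \<longleftrightarrow> distinct es \<and> set es = E"

definition cut_enumeration :: "nat \<Rightarrow> nat set list \<Rightarrow> int vec list \<Rightarrow> bool" where
  "cut_enumeration m es ds \<longleftrightarrow>
     distinct ds \<and> set ds = {cut_vector es C | C. C \<subseteq> {1..m}}"

definition cut_matrix :: "nat set list \<Rightarrow> int vec list \<Rightarrow> int mat" where
  "cut_matrix es ds =
     mat (length es + 1) (length ds) (\<lambda>(i, j). if i < length es then ds ! j $ i else 1)"

definition cut_ideal :: "nat set list \<Rightarrow> int vec list \<Rightarrow> 'k::field mpoly set" where
  "cut_ideal es ds = toric_ideal (cut_matrix es ds)"

end

theory Submission
  imports Defs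
begin

text \<open>
  Going once around a cycle, a vertex set is entered as often as it is left. Hence the cut
  vectors of a cycle with \<open>m\<close> edges are exactly the 0/1 vectors of length \<open>m\<close> with an even sum
  (\<open>cut_vectors_of_cycle\<close>), and \<open>I\<^sub>G\<close> is the ideal of the affine relations among the
  vertices of the half-cube of dimension \<open>m\<close>. For \<open>m < 7\<close>, padding with zeros identifies these
  vectors with a face of the half-cube of dimension 7. Because a sum of two vertices on a face
  decomposes only into vertices on that face, one good order of the 64 vertices in dimension 7
  restricts to a good order for every smaller \<open>m\<close>.

  Goodness of an order is established without Buchberger's criterion. Let \<open>a\<^sub>j\<close> be the columns of
  an integer matrix, ordered linearly, and call \<open>j, k\<close> exchangeable if
  \<open>a\<^sub>j + a\<^sub>k = a\<^sub>c + a\<^sub>d\<close> for columns \<open>c, d\<close> that come before the later one of \<open>j, k\<close>. Then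
  \<open>x\<^sub>j x\<^sub>k\<close> is the initial monomial of a quadratic binomial in the toric ideal. To be shown is that
  the initial monomial \<open>u\<close> of any element of the ideal is divisible by such an \<open>x\<^sub>j x\<^sub>k\<close>. The
  element contains another monomial \<open>v\<close> with the same image as \<open>u\<close>; let \<open>x\<^sub>i\<close> be the
  largest variable at which they differ, so that \<open>u\<close> has the larger exponent there. If \<open>u\<close> is
  divisible by no exchangeable pair, then the variables of \<open>u\<close> before \<open>x\<^sub>i\<close> form a set \<open>W\<close> in which
  no two are exchangeable, with each other or with \<open>i\<close>. Suppose that \<open>W\<close> lies on a face, visible
  from \<open>a\<^sub>i\<close>, of the cone over the columns before \<open>i\<close>: some linear form vanishes on \<open>W\<close>, is
  nonnegative on all columns before \<open>i\<close>, and is negative at \<open>a\<^sub>i\<close>. Applying it to the equal images of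
  \<open>u\<close> and \<open>v\<close> gives a negative number on one side and a nonnegative one on the other. So the order
  is good as soon as each such \<open>W\<close> lies on a visible face
  (\<open>quadratic_lex_groebner_basis_if_visible_faces\<close>). In geometric terms, the lexicographic order
  builds a placing triangulation, and the hypothesis implies that this triangulation is a flag
  complex.

  For the half-cube of dimension 7 this hypothesis is a finite statement. The constant \<open>table\<close> lists
  the 64 vertices in a suitable order, each with a few affine forms that define the
  faces visible from it. The predicate \<open>certified\<close> tests that every set of pairwise nonexchangeable
  vertices lies on one of these faces; it is correct (\<open>certified_sound\<close>), and rewriting evaluates it
  on the table (\<open>table_certified\<close>).
\<close>

abbreviation lookup :: "('a \<Rightarrow>\<^sub>0 'b::zero) \<Rightarrow> 'a \<Rightarrow> 'b" where "lookup \<equiv> Poly_Mapping.lookup"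
abbreviation keys :: "('a \<Rightarrow>\<^sub>0 'b::zero) \<Rightarrow> 'a set" where "keys \<equiv> Poly_Mapping.keys"
abbreviation single :: "'a \<Rightarrow> 'b \<Rightarrow> 'a \<Rightarrow>\<^sub>0 'b::zero" where "single \<equiv> Poly_Mapping.single"

section \<open>Membership in a toric ideal\<close>

definition exponent :: "int mat \<Rightarrow> monomial \<Rightarrow> nat \<Rightarrow>\<^sub>0 int" where
  "exponent A u = (\<Sum>j \<in> keys u. \<Sum>i<dim_row A.
     single i (int (lookup u j) * A $$ (i, j)))"

lemma lookup_sum_single:
  "lookup (\<Sum>i<d. single i (f i)) k = (if k < d then f k else (0::'a::comm_monoid_add))"
  for k d :: nat
  by (simp add: lookup_sum lookup_single when_def)

lemma lookup_exponent:
  "lookup (exponent A u) k =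
     (if k < dim_row A then \<Sum>j \<in> keys u. int (lookup u j) * A $$ (k, j) else 0)"
  unfolding exponent_def lookup_sum[of _ "keys u"] lookup_sum_single by simp

lemma exponent_eq_iff:
  assumes "keys u \<subseteq> {..<n}" and "keys v \<subseteq> {..<n}"
  shows "exponent A u = exponent A v \<longleftrightarrow>
    (\<forall>k<dim_row A. (\<Sum>j<n. int (lookup u j) * A $$ (k, j))
                 = (\<Sum>j<n. int (lookup v j) * A $$ (k, j)))"
proof -
  have *: "(\<Sum>j \<in> keys w. int (lookup w j) * A $$ (k, j))
      = (\<Sum>j<n. int (lookup w j) * A $$ (k, j))"
    if "keys w \<subseteq> {..<n}" for w k
    by (rule sum.mono_neutral_left) (use that in \<open>auto simp: in_keys_iff\<close>)
  show ?thesis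
    by (auto simp: poly_mapping_eq_iff fun_eq_iff lookup_exponent *[OF assms(1)] *[OF assms(2)])
qed

lemma column_monomial_power:
  "(column_monomial A j ^ k :: 'k::field laurent) =
     single (\<Sum>i<dim_row A. single i (int k * A $$ (i, j))) 1"
proof (induction k)
  case (Suc k)
  have "(column_monomial A j ^ Suc k :: 'k laurent) = single
     ((\<Sum>i<dim_row A. single i (A $$ (i, j)))
      + (\<Sum>i<dim_row A. single i (int k * A $$ (i, j)))) 1"
    unfolding power_Suc Suc by (simp add: column_monomial_def mult_single)
  also have "(\<Sum>i<dim_row A. single i (A $$ (i, j)))
      + (\<Sum>i<dim_row A. single i (int k * A $$ (i, j)))
      = (\<Sum>i<dim_row A. single i (int (Suc k) * A $$ (i, j)))"
    by (simp add: sum.distrib[symmetric] single_add[symmetric] algebra_simps)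
  finally show ?case .
qed simp

lemma prod_single_one:
  "(\<Prod>j\<in>J. single (g j) (1::'k::field)) = single (\<Sum>j\<in>J. g j) 1"
proof (induction J rule: infinite_finite_induct)
  case (insert x F)
  then show ?case by (simp add: mult_single)
qed auto

lemma toric_hom_eq:
  "toric_hom A (p::'k::field mpoly) =
     (\<Sum>u \<in> keys p. single (exponent A u) (lookup p u))"
  unfolding toric_hom_def column_monomial_power prod_single_one exponent_def
  by (simp add: mult_single)

text \<open>
  The coefficients of the monomials with a common image add up to zero, so no monomial of an
  element of the ideal can be alone with its image.
\<close>

lemma toric_ideal_same_exponent:
  assumes "p \<in> toric_ideal A" and "u \<in> keys p"
  obtains v where "v \<in> keys p" "v \<noteq> u" "exponent A v = exponent A u"
proof -
  have "0 = lookup (toric_hom A p) (exponent A u)"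
    using assms by (simp add: toric_ideal_def)
  also have "\<dots> = (\<Sum>v \<in> keys p. if exponent A v = exponent A u then lookup p v else 0)"
    by (simp add: toric_hom_eq lookup_sum lookup_single when_def)
  also have "\<dots> = lookup p u +
    (\<Sum>v \<in> keys p - {u}. if exponent A v = exponent A u then lookup p v else 0)"
    using assms(2) by (subst sum.remove[of _ u]) auto
  finally have nonzero:
    "(\<Sum>v \<in> keys p - {u}. if exponent A v = exponent A u then lookup p v else 0) \<noteq> 0"
    using assms(2) by (auto simp: in_keys_iff)
  have "\<exists>v\<in>keys p. v \<noteq> u \<and> exponent A v = exponent A u"
  proof (rule ccontr)
    assume "\<not> ?thesis"
    then have "(\<Sum>v \<in> keys p - {u}. if exponent A v = exponent A u then lookup p v else 0) = 0"
      by (intro sum.neutral) auto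
    then show False using nonzero by simp
  qed
  then show ?thesis using that by blast
qed

lemma keys_diff_single:
  assumes "u \<noteq> v"
  shows "keys (single u (1::'k::field) - single v 1) = {u, v}"
proof -
  have "w \<in> keys (single u (1::'k) - single v 1) \<longleftrightarrow> w = u \<or> w = v" for w
    using assms by (cases "w = u"; cases "w = v") (simp_all add: in_keys_iff lookup_minus lookup_single)
  then show ?thesis by blast
qed

lemma binomial_in_toric_ideal:
  assumes "u \<noteq> v" and "exponent A u = exponent A v"
    and "keys u \<subseteq> {..<dim_col A}" and "keys v \<subseteq> {..<dim_col A}"
  shows "single u (1::'k::field) - single v 1 \<in> toric_ideal A"
proof -
  let ?p = "single u (1::'k) - single v 1"
  have keys: "keys ?p = {u, v}" by (rule keys_diff_single[OF assms(1)])
  have "toric_hom A ?p = single (exponent A u) (lookup ?p u)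
      + single (exponent A v) (lookup ?p v)"
    unfolding toric_hom_eq keys using assms(1) by simp
  also have "\<dots> = single (exponent A v) (lookup ?p u + lookup ?p v)"
    unfolding assms(2) single_add ..
  also have "lookup ?p u + lookup ?p v = 0"
    using assms(1) by (simp add: lookup_minus lookup_single when_def)
  finally have "toric_hom A ?p = 0" by simp
  moreover have "?p \<in> polys (dim_col A)" using assms(3,4) by (auto simp: polys_def keys)
  ultimately show ?thesis by (simp add: toric_ideal_def)
qed

lemma monomial_degree_pair:
  "monomial_degree (single a 1 + single b 1) = 2"
proof -
  have "keys (single a (1::nat) + single b 1) = {a, b}"
    by (auto simp: in_keys_iff lookup_add lookup_single when_def split: if_splits)
  then show ?thesis
    by (cases "a = b") (auto simp: monomial_degree_def lookup_add lookup_single)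
qed

lemma sum_pair:
  fixes a b n :: nat
  assumes "a < n" "b < n"
  shows "(\<Sum>j<n. int (lookup (single a 1 + single b 1) j) * f j) = f a + f b"
proof -
  have "(\<Sum>j<n. int (lookup (single a 1 + single b 1) j) * f j)
    = (\<Sum>j<n. (if j = a then f j else 0) + (if j = b then f j else 0))"
    by (rule sum.cong) (auto simp: lookup_add lookup_single when_def algebra_simps)
  also have "\<dots> = f a + f b" using assms by (simp add: sum.distrib)
  finally show ?thesis .
qed

section \<open>Initial monomials for a lexicographic order\<close>

text \<open>
  Total orders of the variables are given by an injective rank \<open>\<rho>\<close>, because the order is
  constructed below from positions in a list.
\<close>

definition rank_rel :: "nat \<Rightarrow> (nat \<Rightarrow> nat) \<Rightarrow> nat rel" where
  "rank_rel n \<rho> = {(i, j). i < n \<and> j < n \<and> \<rho> i \<le> \<rho> j}"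

lemma linear_order_rank_rel:
  assumes "inj_on \<rho> {..<n}"
  shows "linear_order_on {..<n} (rank_rel n \<rho>)"
  using assms
  by (auto simp: linear_order_on_def partial_order_on_def preorder_on_def refl_on_def trans_def
      antisym_def total_on_def rank_rel_def inj_on_def)

lemma lex_less_rank_rel:
  assumes "inj_on \<rho> {..<n}" "keys u \<subseteq> {..<n}" "keys v \<subseteq> {..<n}"
  shows "lex_less (rank_rel n \<rho>) u v \<longleftrightarrow>
    (\<exists>i<n. lookup u i < lookup v i \<and>
       (\<forall>j<n. \<rho> i < \<rho> j \<longrightarrow> lookup u j = lookup v j))"
proof -
  have *: "i < n" if "lookup u i < lookup v i" for i
    using that assms(3) by (metis in_keys_iff lessThan_iff not_less_zero subsetD)
  have **: "(j \<noteq> i \<and> (i, j) \<in> rank_rel n \<rho>) \<longleftrightarrow> j < n \<and> \<rho> i < \<rho> j" if "i < n" for i j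
    using that assms(1) by (auto simp: rank_rel_def inj_on_def order.strict_iff_order)
  show ?thesis unfolding lex_less_def using * ** by blast
qed

lemma lex_less_total:
  assumes "inj_on \<rho> {..<n}" "keys u \<subseteq> {..<n}" "keys v \<subseteq> {..<n}" "u \<noteq> v"
  shows "lex_less (rank_rel n \<rho>) u v \<or> lex_less (rank_rel n \<rho>) v u"
proof -
  let ?D = "{i. i < n \<and> lookup u i \<noteq> lookup v i}"
  obtain i where i: "lookup u i \<noteq> lookup v i"
    using assms(4) poly_mapping_eqI[of u v] by blast
  have "i < n"
  proof (rule ccontr)
    assume "\<not> i < n"
    then have "i \<notin> keys u" "i \<notin> keys v" using assms(2,3) by auto
    then show False using i by (simp add: in_keys_iff)
  qed
  then have "?D \<noteq> {}" using i by blast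
  then have "Max (\<rho> ` ?D) \<in> \<rho> ` ?D" by (intro Max_in) simp_all
  then obtain k where k: "k \<in> ?D" and k_Max: "Max (\<rho> ` ?D) = \<rho> k" by (rule imageE)
  have k_max: "\<rho> j \<le> \<rho> k" if "j \<in> ?D" for j
    unfolding k_Max[symmetric] using that by (intro Max_ge) simp_all
  have k_less: "k < n" using k by simp
  have above: "lookup u j = lookup v j" if "j < n" "\<rho> k < \<rho> j" for j
  proof (rule ccontr)
    assume "lookup u j \<noteq> lookup v j"
    then have "\<rho> j \<le> \<rho> k" using k_max that(1) by blast
    then show False using that(2) by simp
  qed
  have "lookup u k < lookup v k \<or> lookup v k < lookup u k"
    using k linorder_neqE_nat[of "lookup u k" "lookup v k"] by blast
  then show ?thesis
    unfolding lex_less_rank_rel[OF assms(1-3)] lex_less_rank_rel[OF assms(1,3,2)]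
    using k_less above by metis
qed

lemma lex_less_trans:
  assumes "inj_on \<rho> {..<n}" "keys u \<subseteq> {..<n}" "keys v \<subseteq> {..<n}" "keys w \<subseteq> {..<n}"
    "lex_less (rank_rel n \<rho>) u v" "lex_less (rank_rel n \<rho>) v w"
  shows "lex_less (rank_rel n \<rho>) u w"
proof -
  obtain i where i: "i < n" "lookup u i < lookup v i"
      "\<forall>j<n. \<rho> i < \<rho> j \<longrightarrow> lookup u j = lookup v j"
    using assms by (auto simp: lex_less_rank_rel)
  obtain k where k: "k < n" "lookup v k < lookup w k"
      "\<forall>j<n. \<rho> k < \<rho> j \<longrightarrow> lookup v j = lookup w j"
    using assms by (auto simp: lex_less_rank_rel)
  have "\<exists>l<n. lookup u l < lookup w l \<and>
       (\<forall>j<n. \<rho> l < \<rho> j \<longrightarrow> lookup u j = lookup w j)"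
  proof (cases "\<rho> i" "\<rho> k" rule: linorder_cases)
    case less
    then show ?thesis using i k by (intro exI[of _ k]) auto
  next
    case equal
    then have "i = k" using assms(1) i k by (auto simp: inj_on_def)
    then show ?thesis using i k by (intro exI[of _ k]) auto
  next
    case greater
    then show ?thesis using i k by (intro exI[of _ i]) auto
  qed
  then show ?thesis using assms by (simp add: lex_less_rank_rel)
qed

lemma lex_less_irrefl: "\<not> lex_less r u u"
  by (simp add: lex_less_def)

lemma initial_monomial_eqI:
  assumes "inj_on \<rho> {..<n}" "p \<in> polys n" "u \<in> keys p"
    "\<And>v. v \<in> keys p \<Longrightarrow> v \<noteq> u \<Longrightarrow> lex_less (rank_rel n \<rho>) v u"
  shows "initial_monomial (rank_rel n \<rho>) p = u"
  unfolding initial_monomial_def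
proof (rule the_equality)
  fix w assume w: "w \<in> keys p \<and> (\<forall>v\<in>keys p. v \<noteq> w \<longrightarrow> lex_less (rank_rel n \<rho>) v w)"
  show "w = u"
  proof (rule ccontr)
    assume "w \<noteq> u"
    then have "lex_less (rank_rel n \<rho>) u w" "lex_less (rank_rel n \<rho>) w u" using assms w by auto
    moreover have "keys u \<subseteq> {..<n}" "keys w \<subseteq> {..<n}"
      using assms w by (auto simp: polys_def)
    ultimately show False using lex_less_trans[OF assms(1)] lex_less_irrefl by blast
  qed
qed (use assms in auto)

lemma finite_has_lex_maximum:
  assumes "inj_on \<rho> {..<n}" "finite U" "U \<noteq> {}" "\<And>u. u \<in> U \<Longrightarrow> keys u \<subseteq> {..<n}"
  shows "\<exists>u\<in>U. \<forall>v\<in>U. v \<noteq> u \<longrightarrow> lex_less (rank_rel n \<rho>) v u"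
  using assms(2-4)
proof (induction rule: finite_ne_induct)
  case (insert x F)
  then obtain u where u: "u \<in> F" "\<forall>v\<in>F. v \<noteq> u \<longrightarrow> lex_less (rank_rel n \<rho>) v u"
    by auto
  have "x \<noteq> u" using u insert by auto
  have keys: "keys v \<subseteq> {..<n}" if "v \<in> insert x F" for v
    using insert that by auto
  from lex_less_total[OF assms(1) keys[of x] keys[of u] \<open>x \<noteq> u\<close>] u(1)
  consider "lex_less (rank_rel n \<rho>) x u" | "lex_less (rank_rel n \<rho>) u x" by auto
  then show ?case
  proof cases
    case 1
    then show ?thesis using u by auto
  next
    case 2
    have "lex_less (rank_rel n \<rho>) v x" if "v \<in> F" for v
      using lex_less_trans[OF assms(1) keys[of v] keys[of u] keys[of x]] 2 u that by (cases "v = u") auto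
    then show ?thesis by auto
  qed
qed auto

lemma initial_monomial_maximum:
  assumes "inj_on \<rho> {..<n}" "p \<in> polys n" "p \<noteq> 0"
  shows "initial_monomial (rank_rel n \<rho>) p \<in> keys p"
    and "v \<in> keys p \<Longrightarrow> v \<noteq> initial_monomial (rank_rel n \<rho>) p \<Longrightarrow>
           lex_less (rank_rel n \<rho>) v (initial_monomial (rank_rel n \<rho>) p)"
proof -
  obtain u where u: "u \<in> keys p" "\<forall>v\<in>keys p. v \<noteq> u \<longrightarrow> lex_less (rank_rel n \<rho>) v u"
    using finite_has_lex_maximum[OF assms(1), of "keys p"] assms by (auto simp: polys_def)
  then have "initial_monomial (rank_rel n \<rho>) p = u"
    using initial_monomial_eqI[OF assms(1,2)] by blast
  then show "initial_monomial (rank_rel n \<rho>) p \<in> keys p"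
    and "v \<in> keys p \<Longrightarrow> v \<noteq> initial_monomial (rank_rel n \<rho>) p \<Longrightarrow>
           lex_less (rank_rel n \<rho>) v (initial_monomial (rank_rel n \<rho>) p)"
    using u by auto
qed

section \<open>Generated ideals\<close>

lemma single_in_polys: "keys u \<subseteq> {..<n} \<Longrightarrow> single u c \<in> polys n"
  by (simp add: polys_def)

lemma polys_mult:
  assumes "p \<in> polys n" "q \<in> polys n" shows "p * q \<in> polys n"
  unfolding polys_def
proof safe
  fix u x assume "u \<in> keys (p * q)" "x \<in> keys u"
  then obtain a b where "u = a + b" "a \<in> keys p" "b \<in> keys q"
    using keys_mult[of p q] by blast
  with \<open>x \<in> keys u\<close> have "x \<in> keys a \<or> x \<in> keys b"
    using Poly_Mapping.keys_add[of a b] by blast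
  then show "x < n" using assms \<open>a \<in> _\<close> \<open>b \<in> _\<close> by (auto simp: polys_def)
qed

lemma polys_sum:
  assumes "\<And>x. x \<in> F \<Longrightarrow> p x \<in> polys n" shows "(\<Sum>x\<in>F. p x) \<in> polys n"
  using assms
proof (induction F rule: infinite_finite_induct)
  case (insert x F)
  then have "p x \<in> polys n" "sum p F \<in> polys n" by auto
  then have "p x + sum p F \<in> polys n"
    using Poly_Mapping.keys_add[of "p x" "sum p F"] unfolding polys_def by blast
  then show ?case using insert by simp
qed (auto simp: polys_def)

lemma generated_ideal_mono: "S \<subseteq> T \<Longrightarrow> generated_ideal n S \<subseteq> generated_ideal n T"
  unfolding generated_ideal_def by blast

text \<open>
  An element of a generated ideal is a sum over distinct generators. Several elements of \<open>S\<close> may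
  be multiples of the same element of \<open>T\<close>, so their cofactors have to be collected.
\<close>

lemma generated_ideal_subset_if_multiples:
  assumes "\<And>s. s \<in> S \<Longrightarrow> \<exists>t\<in>T. \<exists>h\<in>polys n. s = h * t"
  shows "generated_ideal n S \<subseteq> generated_ideal n T"
proof
  fix p assume "p \<in> generated_ideal n S"
  then obtain F q where F: "finite F" "F \<subseteq> S" "\<forall>s\<in>F. q s \<in> polys n" "p = (\<Sum>s\<in>F. q s * s)"
    unfolding generated_ideal_def by blast
  from F(2) assms have "\<forall>s\<in>F. \<exists>t. \<exists>h. t \<in> T \<and> h \<in> polys n \<and> s = h * t" by blast
  then obtain t h where th: "\<And>s. s \<in> F \<Longrightarrow> t s \<in> T \<and> h s \<in> polys n \<and> s = h s * t s"
    by metis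
  have "p = (\<Sum>s\<in>F. (q s * h s) * t s)"
    unfolding F(4) by (rule sum.cong[OF refl]) (use th in \<open>metis mult.assoc\<close>)
  also have "\<dots> = (\<Sum>y\<in>t ` F. \<Sum>s\<in>{s\<in>F. t s = y}. (q s * h s) * t s)"
    by (rule sum.image_gen[OF F(1)])
  also have "\<dots> = (\<Sum>y\<in>t ` F. (\<Sum>s\<in>{s\<in>F. t s = y}. q s * h s) * y)"
    unfolding sum_distrib_right by (auto intro!: sum.cong)
  finally have "p = (\<Sum>y\<in>t ` F. (\<Sum>s\<in>{s\<in>F. t s = y}. q s * h s) * y)" .
  moreover have "\<forall>y\<in>t ` F. (\<Sum>s\<in>{s\<in>F. t s = y}. q s * h s) \<in> polys n"
    using F(3) th by (auto intro!: polys_sum polys_mult)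
  moreover have "finite (t ` F)" "t ` F \<subseteq> T" using F(1) th by auto
  ultimately show "p \<in> generated_ideal n T"
    unfolding generated_ideal_def mem_Collect_eq
    by (intro exI[of _ "t ` F"] exI[of _ "\<lambda>y. \<Sum>s\<in>{s\<in>F. t s = y}. q s * h s"] conjI)
qed

section \<open>Visible faces and quadratic Groebner bases\<close>

text \<open>
  The monomial \<open>x\<^sub>a x\<^sub>b\<close> is then the initial monomial of \<open>x\<^sub>a x\<^sub>b - x\<^sub>c x\<^sub>d\<close>, since one of \<open>a, b\<close>
  has a larger rank than \<open>c\<close> and \<open>d\<close>.
\<close>

definition exchangeable_columns :: "int mat \<Rightarrow> (nat \<Rightarrow> nat) \<Rightarrow> nat \<Rightarrow> nat \<Rightarrow> bool" where
  "exchangeable_columns A \<rho> a b \<longleftrightarrow> (\<exists>c<dim_col A. \<exists>d<dim_col A.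
     \<rho> c < max (\<rho> a) (\<rho> b) \<and> \<rho> d < max (\<rho> a) (\<rho> b) \<and>
     (\<forall>k<dim_row A. A $$ (k, a) + A $$ (k, b) = A $$ (k, c) + A $$ (k, d)))"

definition linear_form :: "int mat \<Rightarrow> (nat \<Rightarrow> int) \<Rightarrow> nat \<Rightarrow> int" where
  "linear_form A y j = (\<Sum>k<dim_row A. y k * A $$ (k, j))"

text \<open>
  The set \<open>W\<close> lies on a face of the cone over the columns before \<open>i\<close>, and column \<open>i\<close> is beyond a
  hyperplane that supports this face.
\<close>

definition visible_face :: "int mat \<Rightarrow> (nat \<Rightarrow> nat) \<Rightarrow> nat \<Rightarrow> nat set \<Rightarrow> bool" where
  "visible_face A \<rho> i W \<longleftrightarrow> (\<exists>y. linear_form A y i < 0 \<and>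
     (\<forall>j<dim_col A. \<rho> j < \<rho> i \<longrightarrow> linear_form A y j \<ge> 0) \<and> (\<forall>j\<in>W. linear_form A y j = 0))"

lemma pair_divides:
  assumes "a \<noteq> b" "lookup u a > 0" "lookup u b > 0"
  shows "\<exists>q. u = q + (single a 1 + single b (1::nat))"
proof
  show "u = (u - (single a 1 + single b 1)) + (single a 1 + single b (1::nat))"
    using assms by (intro poly_mapping_eqI) (auto simp: lookup_add lookup_minus lookup_single when_def)
qed

text \<open>
  At the top variable \<open>i\<close> in which \<open>u\<close> and \<open>v\<close> differ, a linear form for the visible face of the
  lower variables of \<open>u\<close> would separate the two equal images: below \<open>i\<close> it vanishes on the part
  of \<open>u\<close> and is nonnegative on the part of \<open>v\<close>, and above \<open>i\<close> the two parts agree.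
\<close>

lemma initial_monomial_has_exchangeable_pair:
  assumes inj: "inj_on \<rho> {..<n}" and n: "n = dim_col A"
    and crit: "\<And>i W. i < n \<Longrightarrow> W \<subseteq> {j. j < n \<and> \<rho> j < \<rho> i} \<Longrightarrow>
        (\<And>j. j \<in> W \<Longrightarrow> \<not> exchangeable_columns A \<rho> i j) \<Longrightarrow>
        (\<And>j k. j \<in> W \<Longrightarrow> k \<in> W \<Longrightarrow> j \<noteq> k \<Longrightarrow> \<not> exchangeable_columns A \<rho> j k) \<Longrightarrow>
        visible_face A \<rho> i W"
    and keys: "keys u \<subseteq> {..<n}" "keys v \<subseteq> {..<n}"
    and eq: "exponent A u = exponent A v" and less: "lex_less (rank_rel n \<rho>) v u"
  shows "\<exists>a<n. \<exists>b<n. a \<noteq> b \<and> lookup u a > 0 \<and> lookup u b > 0 \<and> exchangeable_columns A \<rho> a b"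
proof (rule ccontr)
  assume none: "\<not> ?thesis"
  let ?u = "lookup u" and ?v = "lookup v"
  obtain i where i: "i < n" "?v i < ?u i" "\<And>j. j < n \<Longrightarrow> \<rho> i < \<rho> j \<Longrightarrow> ?v j = ?u j"
    using less by (auto simp: lex_less_rank_rel[OF inj keys(2,1)])
  define W where "W = {j. j < n \<and> \<rho> j < \<rho> i \<and> ?u j > 0}"
  have "visible_face A \<rho> i W"
  proof (rule crit[OF i(1)])
    show "W \<subseteq> {j. j < n \<and> \<rho> j < \<rho> i}" by (auto simp: W_def)
    show "\<not> exchangeable_columns A \<rho> i j" if "j \<in> W" for j
    proof -
      have "j \<noteq> i" "j < n" "0 < ?u j" using that by (auto simp: W_def)
      moreover have "0 < ?u i" using i(2) by simp
      ultimately show ?thesis using none i(1) by blast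
    qed
    show "\<not> exchangeable_columns A \<rho> j k" if "j \<in> W" "k \<in> W" "j \<noteq> k" for j k
      using none that unfolding W_def by blast
  qed
  then obtain y where y: "linear_form A y i < 0"
      "\<And>j. j < n \<Longrightarrow> \<rho> j < \<rho> i \<Longrightarrow> linear_form A y j \<ge> 0"
      "\<And>j. j \<in> W \<Longrightarrow> linear_form A y j = 0"
    unfolding visible_face_def n by blast
  have weighted: "(\<Sum>j<n. int (w j) * linear_form A y j) =
      (\<Sum>k<dim_row A. y k * (\<Sum>j<n. int (w j) * A $$ (k, j)))" for w
    unfolding linear_form_def sum_distrib_left
    by (subst sum.swap) (simp add: algebra_simps)
  have "(\<Sum>j<n. int (?u j) * linear_form A y j) = (\<Sum>j<n. int (?v j) * linear_form A y j)"
    using eq unfolding weighted exponent_eq_iff[OF keys] by simp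
  then have "0 = (\<Sum>j<n. (int (?u j) - int (?v j)) * linear_form A y j)"
    by (simp add: left_diff_distrib sum_subtractf)
  also have "\<dots> < (\<Sum>j<n. 0)"
  proof (rule sum_strict_mono_ex1)
    show "\<forall>j\<in>{..<n}. (int (?u j) - int (?v j)) * linear_form A y j \<le> 0"
    proof
      fix j assume "j \<in> {..<n}"
      then have j: "j < n" by simp
      consider "j = i" | "\<rho> j < \<rho> i" | "\<rho> i < \<rho> j"
        using inj i(1) j by (metis inj_onD lessThan_iff linorder_neqE_nat)
      then show "(int (?u j) - int (?v j)) * linear_form A y j \<le> 0"
      proof cases
        case 1
        then show ?thesis using i(2) y(1) by (intro mult_nonneg_nonpos) auto
      next
        case 2
        show ?thesis
        proof (cases "?u j > 0")
          case True
          then have "j \<in> W" using 2 j by (simp add: W_def)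
          then show ?thesis using y(3) by simp
        next
          case False
          then show ?thesis using y(2)[OF j 2] by (intro mult_nonpos_nonneg) auto
        qed
      next
        case 3
        then show ?thesis using i(3) j by simp
      qed
    qed
    show "\<exists>j\<in>{..<n}. (int (?u j) - int (?v j)) * linear_form A y j < 0"
      using i y(1) by (intro bexI[of _ i] mult_pos_neg) auto
  qed simp
  finally show False by simp
qed

text \<open>
  All quadratic binomials in the ideal together serve as the basis: every initial monomial is a
  multiple of some \<open>x\<^sub>a x\<^sub>b\<close> for an exchangeable pair, which is the initial monomial of one of them.
\<close>

theorem quadratic_lex_groebner_basis_if_visible_faces:
  fixes A :: "int mat" and \<rho> :: "nat \<Rightarrow> nat"
  assumes inj: "inj_on \<rho> {..<dim_col A}"
    and crit: "\<And>i W. i < dim_col A \<Longrightarrow> W \<subseteq> {j. j < dim_col A \<and> \<rho> j < \<rho> i} \<Longrightarrow>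
        (\<And>j. j \<in> W \<Longrightarrow> \<not> exchangeable_columns A \<rho> i j) \<Longrightarrow>
        (\<And>j k. j \<in> W \<Longrightarrow> k \<in> W \<Longrightarrow> j \<noteq> k \<Longrightarrow> \<not> exchangeable_columns A \<rho> j k) \<Longrightarrow>
        visible_face A \<rho> i W"
  shows "\<exists>B :: 'k::field mpoly set.
     lex_groebner_basis (dim_col A) (rank_rel (dim_col A) \<rho>) (toric_ideal A) B \<and>
     (\<forall>g\<in>B. quadratic_binomial g)"
proof -
  define n where "n = dim_col A"
  let ?r = "rank_rel n \<rho>"
  let ?x = "\<lambda>a b :: nat. single a (1::nat) + single b 1"
  define B :: "'k mpoly set" where
    "B = {single (?x a b) 1 - single (?x c d) 1 | a b c d.
            a < n \<and> b < n \<and> c < n \<and> d < n \<and> ?x a b \<noteq> ?x c d \<and>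
            exponent A (?x a b) = exponent A (?x c d)}"
  have keys_x: "keys (?x a b) \<subseteq> {..<n}" if "a < n" "b < n" for a b
    using that Poly_Mapping.keys_add[of "single a (1::nat)" "single b 1"] by auto
  have "B \<subseteq> (\<lambda>(a, b, c, d). single (?x a b) 1 - single (?x c d) 1) `
      ({..<n} \<times> {..<n} \<times> {..<n} \<times> {..<n})"
    unfolding B_def by force
  then have "finite B" by (rule finite_subset) simp
  have BI: "B \<subseteq> toric_ideal A"
    unfolding B_def using binomial_in_toric_ideal keys_x unfolding n_def by blast
  have zero: "0 \<notin> B"
  proof
    assume "0 \<in> B"
    then obtain a b c d :: nat where "?x a b \<noteq> ?x c d"
      "0 = single (?x a b) (1::'k) - single (?x c d) 1" unfolding B_def by blast
    then show False using keys_diff_single[of "?x a b" "?x c d", where 'k='k]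
      by (metis insert_not_empty keys_zero)
  qed
  have quadratic: "\<forall>g\<in>B. quadratic_binomial g"
    unfolding B_def quadratic_binomial_def using monomial_degree_pair by blast
  have multiple: "\<exists>g\<in>B. \<exists>q. keys q \<subseteq> {..<n} \<and> initial_monomial ?r f = q + initial_monomial ?r g"
    if f: "f \<in> toric_ideal A" "f \<noteq> 0" for f :: "'k mpoly"
  proof -
    define u where "u = initial_monomial ?r f"
    have fpoly: "f \<in> polys n" using f by (simp add: toric_ideal_def n_def)
    have inj': "inj_on \<rho> {..<n}" using inj n_def by simp
    have u: "u \<in> keys f"
      "\<And>v. v \<in> keys f \<Longrightarrow> v \<noteq> u \<Longrightarrow> lex_less ?r v u"
      using initial_monomial_maximum[OF inj' fpoly f(2)] unfolding u_def by auto
    obtain v where v: "v \<in> keys f" "v \<noteq> u" "exponent A v = exponent A u"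
      using toric_ideal_same_exponent[OF f(1) u(1)] .
    have ku: "keys u \<subseteq> {..<n}" and kv: "keys v \<subseteq> {..<n}"
      using fpoly u(1) v(1) by (auto simp: polys_def)
    obtain a b where ab: "a < n" "b < n" "a \<noteq> b" "lookup u a > 0" "lookup u b > 0"
      "exchangeable_columns A \<rho> a b"
      using initial_monomial_has_exchangeable_pair[OF inj' n_def crit[folded n_def] ku kv
          v(3)[symmetric] u(2)[OF v(1,2)]]
      by blast
    obtain c d where cd: "c < n" "d < n" "\<rho> c < max (\<rho> a) (\<rho> b)" "\<rho> d < max (\<rho> a) (\<rho> b)"
      "\<forall>k<dim_row A. A $$ (k, a) + A $$ (k, b) = A $$ (k, c) + A $$ (k, d)"
      using ab(6) unfolding exchangeable_columns_def n_def by blast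
    obtain q where q: "u = q + ?x a b" using pair_divides[OF ab(3-5)] by blast
    have "keys q \<subseteq> keys u"
      unfolding q by (auto simp: in_keys_iff lookup_add)
    then have kq: "keys q \<subseteq> {..<n}" using ku by simp
    have less: "lex_less ?r (?x c d) (?x a b)"
    proof -
      have c: "c \<noteq> e \<and> d \<noteq> e" if "\<rho> e \<ge> max (\<rho> a) (\<rho> b)" for e using cd that by auto
      define i where "i = (if \<rho> a \<le> \<rho> b then b else a)"
      have i: "i < n" "\<rho> i = max (\<rho> a) (\<rho> b)" "i = a \<or> i = b" using ab by (auto simp: i_def)
      have "lookup (?x c d) i < lookup (?x a b) i"
        using c[of i] i by (auto simp: lookup_add lookup_single when_def)
      moreover have "lookup (?x c d) j = lookup (?x a b) j" if "\<rho> i < \<rho> j" for j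
        using c[of j] i that by (auto simp: lookup_add lookup_single when_def)
      ultimately show ?thesis
        using i(1) unfolding lex_less_rank_rel[OF inj' keys_x[OF cd(1,2)] keys_x[OF ab(1,2)]]
        by blast
    qed
    then have ne: "?x a b \<noteq> ?x c d" using lex_less_irrefl by metis
    have exp: "exponent A (?x a b) = exponent A (?x c d)"
      unfolding exponent_eq_iff[OF keys_x[OF ab(1,2)] keys_x[OF cd(1,2)]]
      using cd(5) by (simp only: sum_pair[OF ab(1,2)] sum_pair[OF cd(1,2)])
    define g :: "'k mpoly" where "g = single (?x a b) 1 - single (?x c d) 1"
    have gB: "g \<in> B" unfolding B_def g_def using ab cd ne exp by blast
    then have gpoly: "g \<in> polys n" using BI by (auto simp: toric_ideal_def n_def)
    have kg: "keys g = {?x a b, ?x c d}" unfolding g_def by (rule keys_diff_single[OF ne])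
    have "initial_monomial ?r g = ?x a b"
      by (rule initial_monomial_eqI[OF inj' gpoly]) (use less kg in auto)
    then show ?thesis using gB kq q u_def by metis
  qed
  have "generated_ideal n {single (initial_monomial ?r g) (1::'k) | g. g \<in> B}
      = initial_ideal n ?r (toric_ideal A)"
  proof
    show "generated_ideal n {single (initial_monomial ?r g) (1::'k) | g. g \<in> B}
        \<subseteq> initial_ideal n ?r (toric_ideal A)"
      unfolding initial_ideal_def using BI zero by (intro generated_ideal_mono) blast
    show "initial_ideal n ?r (toric_ideal A)
        \<subseteq> generated_ideal n {single (initial_monomial ?r g) (1::'k) | g. g \<in> B}"
      unfolding initial_ideal_def
    proof (rule generated_ideal_subset_if_multiples)
      fix s :: "'k mpoly" assume "s \<in> {single (initial_monomial ?r f) 1 | f :: 'k mpoly.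
        f \<in> toric_ideal A \<and> f \<noteq> 0}"
      then obtain f :: "'k mpoly" where f: "f \<in> toric_ideal A" "f \<noteq> 0"
          "s = single (initial_monomial ?r f) 1"
        by blast
      obtain g q where g: "g \<in> B" "keys q \<subseteq> {..<n}"
          "initial_monomial ?r f = q + initial_monomial ?r g"
        using multiple[OF f(1,2)] by blast
      have "s = single q 1 * single (initial_monomial ?r g) 1"
        by (simp add: f(3) g(3) mult_single)
      then show "\<exists>t\<in>{single (initial_monomial ?r g) 1 |g. g \<in> B}. \<exists>h\<in>polys n. s = h * t"
        using g(1) single_in_polys[OF g(2)] by blast
    qed
  qed
  then show ?thesis
    unfolding lex_groebner_basis_def n_def[symmetric] using \<open>finite B\<close> BI zero quadratic by blast
qed

section \<open>Cuts of a cycle\<close>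

lemma card_inter_pair_eq_1_iff:
  assumes "x \<noteq> y" shows "card (C \<inter> {x, y}) = 1 \<longleftrightarrow> (x \<in> C) \<noteq> (y \<in> C)"
  using assms by (cases "x \<in> C"; cases "y \<in> C") simp_all

lemma sum_rotate:
  fixes g :: "nat \<Rightarrow> int" assumes "0 < m"
  shows "(\<Sum>i<m. g (Suc i mod m)) = (\<Sum>i<m. g i)"
proof -
  obtain k where m: "m = Suc k" using assms by (cases m) auto
  have "(\<Sum>i<k. g (Suc i mod Suc k)) = (\<Sum>i<k. g (Suc i))" by (rule sum.cong) auto
  then show ?thesis unfolding m by (subst (2) sum.lessThan_Suc_shift) simp
qed

lemma inj_on_cycle_edges:
  assumes f: "inj_on f {..<m}" and m: "3 \<le> m"
  shows "inj_on (\<lambda>i. {f i, f (Suc i mod m)}) {..<m}"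
proof (rule inj_onI)
  fix i j assume i: "i \<in> {..<m}" and j: "j \<in> {..<m}"
    and eq: "{f i, f (Suc i mod m)} = {f j, f (Suc j mod m)}"
  have f_eq: "f a = f b \<longleftrightarrow> a = b" if "a < m" "b < m" for a b
    using f that by (auto dest: inj_onD)
  have "i < m" "j < m" "Suc i mod m < m" "Suc j mod m < m" using i j m by auto
  with eq consider "i = j" | "i = Suc j mod m" "Suc i mod m = j"
    by (auto simp: doubleton_eq_iff f_eq)
  then show "i = j"
  proof cases
    case 2
    then show ?thesis using i j m by (auto simp: mod_Suc split: if_splits)
  qed
qed

definition even_vectors :: "nat \<Rightarrow> int vec set" where
  "even_vectors m = {v. dim_vec v = m \<and> (\<forall>i<m. v $ i \<in> {0, 1}) \<and> even (\<Sum>i<m. v $ i)}"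

lemma sum_edges:
  fixes g :: "nat set \<Rightarrow> int"
  assumes "distinct es" and "set es = e ` {..<m}" and "inj_on e {..<m}"
  shows "(\<Sum>p<length es. g (es ! p)) = (\<Sum>i<m. g (e i))"
proof -
  have "(\<Sum>p<length es. g (es ! p)) = sum g (set es)"
    by (rule sum.reindex_bij_betw) (rule bij_betw_nth[OF assms(1) refl refl])
  also have "\<dots> = (\<Sum>i<m. g (e i))" unfolding assms(2) by (rule sum.reindex[OF assms(3), unfolded comp_def])
  finally show ?thesis .
qed

text \<open>
  Walking along the cycle, membership in \<open>C\<close> changes exactly at the edges of the cut. Back at
  the start it must have changed an even number of times. Conversely, an even vector prescribes the
  changes, and the vertices reached after an odd number of changes form a set with this cut.
\<close>

lemma cut_vectors_of_cycle:
  assumes "is_cycle m E" and "edge_enumeration E es"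
  shows "length es = m" and "{cut_vector es C | C. C \<subseteq> {1..m}} = even_vectors m"
proof -
  obtain f where m: "3 \<le> m" and bij: "bij_betw f {..<m} {1..m}"
      and E: "E = {{f i, f (Suc i mod m)} | i. i < m}"
    using assms(1) unfolding is_cycle_def by blast
  have inj: "inj_on f {..<m}" using bij by (rule bij_betw_imp_inj_on)
  define e where "e = (\<lambda>i. {f i, f (Suc i mod m)})"
  have inj_e: "inj_on e {..<m}" unfolding e_def by (rule inj_on_cycle_edges[OF inj m])
  have es: "distinct es" "set es = e ` {..<m}"
    using assms(2) E unfolding edge_enumeration_def e_def by auto
  show len: "length es = m"
    using distinct_card[OF es(1)] es(2) card_image[OF inj_e] by simp
  have ends: "f i \<noteq> f (Suc i mod m)" if "i < m" for i
    using inj_onD[OF inj, of i "Suc i mod m"] that m by (auto simp: mod_Suc split: if_splits)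
  have crossing: "card (C \<inter> e i) = 1 \<longleftrightarrow> (f i \<in> C) \<noteq> (f (Suc i mod m) \<in> C)" if "i < m" for C i
    unfolding e_def by (rule card_inter_pair_eq_1_iff[OF ends[OF that]])
  show "{cut_vector es C | C. C \<subseteq> {1..m}} = even_vectors m"
  proof (intro equalityI subsetI)
    fix v assume "v \<in> {cut_vector es C | C. C \<subseteq> {1..m}}"
    then obtain C where v: "v = cut_vector es C" by blast
    have "(\<Sum>p<m. v $ p) = (\<Sum>p<length es. if card (C \<inter> es ! p) = 1 then 1 else 0)"
      unfolding v cut_vector_def len[symmetric] by (rule sum.cong) auto
    also have "\<dots> = (\<Sum>i<m. if card (C \<inter> e i) = 1 then 1 else 0)"
      by (rule sum_edges[OF es inj_e])
    also have "\<dots> = (\<Sum>i<m. of_bool (f i \<in> C) + of_bool (f (Suc i mod m) \<in> C)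
        - 2 * of_bool (f i \<in> C \<and> f (Suc i mod m) \<in> C))"
    proof (rule sum.cong[OF refl])
      fix i assume "i \<in> {..<m}"
      then have "i < m" by simp
      then show "(if card (C \<inter> e i) = 1 then 1 else 0) =
          of_bool (f i \<in> C) + of_bool (f (Suc i mod m) \<in> C)
        - 2 * (of_bool (f i \<in> C \<and> f (Suc i mod m) \<in> C) :: int)"
        unfolding crossing[OF \<open>i < m\<close>] by auto
    qed
    also have "\<dots> = 2 * ((\<Sum>i<m. of_bool (f i \<in> C))
        - (\<Sum>i<m. of_bool (f i \<in> C \<and> f (Suc i mod m) \<in> C)))"
      using sum_rotate[of m "\<lambda>i. of_bool (f i \<in> C)"] m
      by (simp add: sum.distrib sum_subtractf sum_distrib_left right_diff_distrib)
    finally have "even (\<Sum>p<m. v $ p)" by simp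
    then show "v \<in> even_vectors m"
      unfolding even_vectors_def v by (simp add: cut_vector_def len)
  next
    fix v assume v: "v \<in> even_vectors m"
    \<comment> \<open>The value of \<open>v\<close> at an edge, independently of the position of the edge in the enumeration.\<close>
    define h where "h x = v $ (THE p. p < m \<and> es ! p = x)" for x
    have h_nth: "h (es ! p) = v $ p" if "p < m" for p
    proof -
      have "(THE q. q < m \<and> es ! q = es ! p) = p"
        using that es(1) len by (intro the_equality) (auto simp: nth_eq_iff_index_eq)
      then show ?thesis by (simp add: h_def)
    qed
    define S where "S i = (\<Sum>k<i. h (e k))" for i
    have "S m = (\<Sum>p<m. v $ p)"
      unfolding S_def using sum_edges[OF es inj_e, of h] h_nth len by simp
    then have S_m: "even (S m)" using v by (simp add: even_vectors_def)
    have h01: "h (e i) = 0 \<or> h (e i) = 1" if "i < m" for i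
    proof -
      have "e i \<in> set es" using es(2) that by auto
      then obtain p where "p < m" "es ! p = e i" using len by (auto simp: in_set_conv_nth)
      then show ?thesis using h_nth[of p] v by (auto simp: even_vectors_def)
    qed
    define C where "C = f ` {i. i < m \<and> odd (S i)}"
    have f_C: "f i \<in> C \<longleftrightarrow> odd (S i)" if "i < m" for i
      unfolding C_def using inj_on_image_mem_iff[OF inj, of i "{i. i < m \<and> odd (S i)}"] that by auto
    \<comment> \<open>The last edge closes up with vertex \<open>f 0\<close> because the total number of changes is even.\<close>
    have f_C_next: "f (Suc i mod m) \<in> C \<longleftrightarrow> odd (S (Suc i))" if "i < m" for i
    proof (cases "Suc i = m")
      case True
      then show ?thesis using f_C[of 0] S_m m by (simp add: S_def)
    next
      case False
      then show ?thesis using f_C[of "Suc i"] that by simp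
    qed
    have cut: "(if card (C \<inter> e i) = 1 then 1 else 0) = h (e i)" if "i < m" for i
      unfolding crossing[OF that] f_C[OF that] f_C_next[OF that]
      using h01[OF that] by (auto simp: S_def)
    have "cut_vector es C = v"
    proof (rule eq_vecI)
      show "dim_vec (cut_vector es C) = dim_vec v"
        using v by (simp add: cut_vector_def even_vectors_def len)
      fix p assume "p < dim_vec v"
      then have p: "p < m" using v by (simp add: even_vectors_def)
      then have "es ! p \<in> e ` {..<m}" using es(2) len nth_mem by metis
      then obtain i where "i < m" "es ! p = e i" by blast
      then show "cut_vector es C $ p = v $ p"
        using cut[of i] h_nth[OF p] p by (simp add: cut_vector_def len)
    qed
    moreover have "C \<subseteq> {1..m}" unfolding C_def using bij by (auto simp: bij_betw_def)
    ultimately show "v \<in> {cut_vector es C | C. C \<subseteq> {1..m}}" by blast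
  qed
qed

section \<open>Certificates for visible faces\<close>

definition exchangeable :: "int list set \<Rightarrow> int list \<Rightarrow> int list \<Rightarrow> bool" where
  "exchangeable L a b \<longleftrightarrow> (\<exists>c\<in>L. \<exists>d\<in>L. map2 (+) c d = map2 (+) a b)"

text \<open>
  Exchangeability with respect to a list of points in increasing order: the pair is replaced by points
  that precede the later one of the two.
\<close>

definition exchangeable_in :: "int list list \<Rightarrow> int list \<Rightarrow> int list \<Rightarrow> bool" where
  "exchangeable_in order a b \<longleftrightarrow> (\<exists>us z vs. order = us @ z # vs \<and>
     (z = a \<and> b \<in> set us \<or> z = b \<and> a \<in> set us) \<and> exchangeable (set us) a b)"

text \<open>
  Sets of 0/1 vectors of a fixed length, branching on one coordinate per level: \<open>Node\<close> holds the
  vectors that start with 0 and those that start with 1, and \<open>Point\<close> marks a complete vector.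
  Descending simultaneously in two tries decides quickly whether a pair of vectors is exchangeable.
\<close>

datatype trie = Empty | Point | Node trie trie

fun trie_points :: "trie \<Rightarrow> int list set" where
  "trie_points Empty = {}"
| "trie_points Point = {[]}"
| "trie_points (Node s t) = (#) 0 ` trie_points s \<union> (#) 1 ` trie_points t"

fun insert_point :: "int list \<Rightarrow> trie \<Rightarrow> trie" where
  "insert_point [] t = Point"
| "insert_point (x # xs) (Node s t) =
     (if x = 0 then Node (insert_point xs s) t else Node s (insert_point xs t))"
| "insert_point (x # xs) t =
     (if x = 0 then Node (insert_point xs Empty) Empty else Node Empty (insert_point xs Empty))"

text \<open>
  A sum \<open>a + b\<close> of 0/1 vectors leaves no choice in the coordinates where \<open>a\<close> and \<open>b\<close>
  agree; where they differ, either summand may take the 1. The conditional in place of a disjunction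
  lets rewriting stop at the first success.
\<close>

fun splits :: "int list \<Rightarrow> int list \<Rightarrow> trie \<Rightarrow> trie \<Rightarrow> bool" where
  "splits (x # xs) (y # ys) (Node s0 s1) (Node t0 t1) =
    (if x = y then if x = 0 then splits xs ys s0 t0 else splits xs ys s1 t1
     else if splits xs ys s0 t1 then True else splits xs ys s1 t0)"
| "splits [] [] Point Point = True"
| "splits _ _ _ _ = False"

fun dot :: "int list \<Rightarrow> int list \<Rightarrow> int" where
  "dot (k # ks) (x # xs) = (if x = 0 then dot ks xs else k + dot ks xs)"
| "dot _ _ = 0"

text \<open>
  The first entry is the constant term.
\<close>

fun affine :: "int list \<Rightarrow> int list \<Rightarrow> int" where
  "affine (k # ks) xs = k + dot ks xs"
| "affine [] xs = 0"

text \<open>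
  A processed point together with the earlier points with which it is not exchangeable. Pairs are
  thus recorded at their later member only, which is why \<open>linked\<close> looks at both lists.
\<close>

type_synonym vertex = "int list \<times> int list list"

definition linked :: "vertex \<Rightarrow> vertex \<Rightarrow> bool" where
  "linked p q = (if List.member (snd p) (fst q) then True else List.member (snd q) (fst p))"

text \<open>
  Each set of pairwise linked vertices in \<open>X\<close> lies in the zero set of one of the forms. Such a
  set either lies in the zero set of the first form or contains a vertex \<open>p\<close> outside of it; then the
  remaining members are linked to \<open>p\<close>, and only forms that vanish at \<open>p\<close> are still possible.
\<close>

fun covered :: "vertex list \<Rightarrow> int list list \<Rightarrow> bool" where
  "covered X [] = False"
| "covered X (l # ls) = list_all
     (\<lambda>p. covered (filter (linked p) X) (filter (\<lambda>l'. affine l' (fst p) = 0) ls))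
     (filter (\<lambda>p. affine l (fst p) \<noteq> 0) X)"

definition separating :: "int list \<Rightarrow> vertex list \<Rightarrow> int list \<Rightarrow> bool" where
  "separating a ps l \<longleftrightarrow> affine l a < 0 \<and> list_all (\<lambda>p. 0 \<le> affine l (fst p)) ps"

text \<open>
  The rows are processed in increasing order; \<open>T\<close> holds the points of the processed rows and \<open>ps\<close>
  the corresponding vertices, the latest first. Passing the list \<open>X\<close> of linked vertices as an
  argument to a second function makes rewriting evaluate it only once.
\<close>

fun certified :: "trie \<Rightarrow> vertex list \<Rightarrow> (int list \<times> int list list) list \<Rightarrow> bool"
  and certified_row :: "trie \<Rightarrow> vertex list \<Rightarrow> int list \<Rightarrow> vertex list \<Rightarrow> int list list \<Rightarrow>
    (int list \<times> int list list) list \<Rightarrow> bool"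
where
  "certified T ps [] = True"
| "certified T ps ((a, ls) # rs) =
     (if list_all (separating a ps) ls
      then certified_row T ps a (filter (\<lambda>p. \<not> splits a (fst p) T T) ps) ls rs else False)"
| "certified_row T ps a X ls rs =
     (if covered X ls then certified (insert_point a T) ((a, map fst X) # ps) rs else False)"

section \<open>Correctness of certificates\<close>

lemma trie_points_insert:
  "set a \<subseteq> {0, 1} \<Longrightarrow> trie_points (insert_point a T) \<subseteq> insert a (trie_points T)"
  by (induction a T rule: insert_point.induct) (auto simp: image_iff)

lemma splits_sound:
  "splits a b S T \<Longrightarrow> set a \<subseteq> {0, 1} \<Longrightarrow> set b \<subseteq> {0, 1} \<Longrightarrow>
     \<exists>c\<in>trie_points S. \<exists>d\<in>trie_points T. map2 (+) c d = map2 (+) a b"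
proof (induction a b S T rule: splits.induct)
  case (1 x xs y ys s0 s1 t0 t1)
  have x: "x = 0 \<or> x = 1" "set xs \<subseteq> {0, 1}" and y: "y = 0 \<or> y = 1" "set ys \<subseteq> {0, 1}"
    using 1(6,7) by auto
  consider "x = 0" "y = 0" "splits xs ys s0 t0" | "x = 1" "y = 1" "splits xs ys s1 t1"
    | "x + y = 1" "splits xs ys s0 t1" | "x + y = 1" "splits xs ys s1 t0"
    using 1(5) x(1) y(1) by (auto split: if_splits)
  then show ?case
  proof cases
    case 1: 1
    then obtain c d where "c \<in> trie_points s0" "d \<in> trie_points t0" "map2 (+) c d = map2 (+) xs ys"
      using "1.IH"(1) x(2) y(2) by auto
    then show ?thesis using 1 by (intro bexI[of _ "0 # c"] bexI[of _ "0 # d"]) auto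
  next
    case 2: 2
    then obtain c d where "c \<in> trie_points s1" "d \<in> trie_points t1" "map2 (+) c d = map2 (+) xs ys"
      using "1.IH"(2) x(2) y(2) by auto
    then show ?thesis using 2 by (intro bexI[of _ "1 # c"] bexI[of _ "1 # d"]) auto
  next
    case 3: 3
    then obtain c d where "c \<in> trie_points s0" "d \<in> trie_points t1" "map2 (+) c d = map2 (+) xs ys"
      using "1.IH"(3) x y by auto
    then show ?thesis using 3 by (intro bexI[of _ "0 # c"] bexI[of _ "1 # d"]) auto
  next
    case 4: 4
    show ?thesis
    proof (cases "splits xs ys s0 t1")
      case True
      then obtain c d where "c \<in> trie_points s0" "d \<in> trie_points t1" "map2 (+) c d = map2 (+) xs ys"
        using "1.IH"(3) x y 4 by auto
      then show ?thesis using 4 by (intro bexI[of _ "0 # c"] bexI[of _ "1 # d"]) auto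
    next
      case False
      then obtain c d where "c \<in> trie_points s1" "d \<in> trie_points t0" "map2 (+) c d = map2 (+) xs ys"
        using "1.IH"(4) x y 4 by auto
      then show ?thesis using 4 by (intro bexI[of _ "1 # c"] bexI[of _ "0 # d"]) auto
    qed
  qed
qed auto

lemma exchangeable_mono: "exchangeable L a b \<Longrightarrow> L \<subseteq> M \<Longrightarrow> exchangeable M a b"
  unfolding exchangeable_def by blast

lemma map2_plus_commute: "map2 (+) a b = map2 (+) b (a :: int list)"
  by (subst zip_commute) (auto simp: add.commute)

lemma exchangeable_commute: "exchangeable L a b \<longleftrightarrow> exchangeable L b a"
  unfolding exchangeable_def by (metis map2_plus_commute)

lemma exchangeable_in_commute: "exchangeable_in order a b \<longleftrightarrow> exchangeable_in order b a"
  unfolding exchangeable_in_def using exchangeable_commute by metis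

lemma exchangeable_in_append:
  "exchangeable_in us a b \<Longrightarrow> exchangeable_in (us @ vs) a b"
  unfolding exchangeable_in_def by (metis append.assoc append_Cons)

text \<open>
  The induction follows the branching: a member \<open>p\<close> of \<open>W\<close> outside the zero set of the first form is
  put aside, and the form found for the other members vanishes at \<open>p\<close> by the choice of forms.
\<close>

lemma covered_sound:
  "covered X ls \<Longrightarrow> W \<subseteq> set X \<Longrightarrow> (\<And>p q. p \<in> W \<Longrightarrow> q \<in> W \<Longrightarrow> p \<noteq> q \<Longrightarrow> linked p q) \<Longrightarrow>
     \<exists>l\<in>set ls. \<forall>p\<in>W. affine l (fst p) = 0"
proof (induction X ls arbitrary: W rule: covered.induct)
  case (2 X l ls)
  show ?case
  proof (cases "\<forall>p\<in>W. affine l (fst p) = 0")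
    case False
    then obtain p where p: "p \<in> W" "affine l (fst p) \<noteq> 0" by blast
    have "p \<in> set (filter (\<lambda>p. affine l (fst p) \<noteq> 0) X)" using p 2(3) by auto
    moreover from 2(2) this have "covered (filter (linked p) X) (filter (\<lambda>l'. affine l' (fst p) = 0) ls)"
      unfolding covered.simps list_all_iff by (rule bspec)
    moreover have "W - {p} \<subseteq> set (filter (linked p) X)"
    proof
      fix q assume "q \<in> W - {p}"
      then have "linked p q" "q \<in> set X" using 2(4)[OF p(1), of q] 2(3) by blast+
      then show "q \<in> set (filter (linked p) X)" by simp
    qed
    ultimately have "\<exists>l'\<in>set (filter (\<lambda>l'. affine l' (fst p) = 0) ls).
        \<forall>q\<in>W - {p}. affine l' (fst q) = 0"
      by (rule 2(1)) (use 2(4) in auto)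
    then show ?thesis by auto
  qed auto
qed auto

text \<open>
  The invariant of \<open>certified\<close>: a point missing from the list of a later vertex is exchangeable with
  it, by means of points before that vertex. As \<open>ps\<close> is in decreasing order, these are the points that
  follow it.
\<close>

definition sound_state :: "trie \<Rightarrow> vertex list \<Rightarrow> bool" where
  "sound_state T ps \<longleftrightarrow> trie_points T \<subseteq> fst ` set ps \<and> (\<forall>p\<in>set ps. set (fst p) \<subseteq> {0, 1}) \<and>
     (\<forall>us b S vs c. ps = us @ (b, S) # vs \<longrightarrow> c \<in> fst ` set vs \<longrightarrow> c \<notin> set S \<longrightarrow>
        exchangeable (fst ` set vs) b c)"

lemma sound_state_step:
  assumes "sound_state T ps" and "set a \<subseteq> {0, 1}"
  shows "sound_state (insert_point a T)
     ((a, map fst (filter (\<lambda>p. \<not> splits a (fst p) T T) ps)) # ps)"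
proof -
  let ?S = "map fst (filter (\<lambda>p. \<not> splits a (fst p) T T) ps)"
  have T: "trie_points T \<subseteq> fst ` set ps" and bin: "\<forall>p\<in>set ps. set (fst p) \<subseteq> {0, 1}"
    using assms(1) by (auto simp: sound_state_def)
  have "exchangeable (fst ` set ps) a c" if c: "c \<in> fst ` set ps" "c \<notin> set ?S" for c
  proof -
    have "splits a c T T" using c by auto
    moreover have "set c \<subseteq> {0, 1}" using c(1) bin by auto
    ultimately have "exchangeable (trie_points T) a c"
      using splits_sound[of a c T T] assms(2) unfolding exchangeable_def by blast
    then show ?thesis using T exchangeable_mono by blast
  qed
  then have "\<forall>us b S vs c. (a, ?S) # ps = us @ (b, S) # vs \<longrightarrow> c \<in> fst ` set vs \<longrightarrow> c \<notin> set S \<longrightarrow>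
        exchangeable (fst ` set vs) b c"
    using assms(1) unfolding sound_state_def Cons_eq_append_conv by blast
  then show ?thesis
    using trie_points_insert[OF assms(2), of T] T bin assms(2) unfolding sound_state_def by auto
qed

lemma certified_reaches_row:
  assumes "certified T ps rs" and "sound_state T ps"
    and "\<forall>r\<in>set rs. set (fst r) \<subseteq> {0, 1}"
    and "rs = xs @ (a, ls) # ys"
  shows "\<exists>T' ps'. map fst ps' = rev (map fst xs) @ map fst ps \<and> sound_state T' ps' \<and>
     list_all (separating a ps') ls \<and> covered (filter (\<lambda>p. \<not> splits a (fst p) T' T') ps') ls"
  using assms
proof (induction xs arbitrary: T ps rs)
  case Nil
  then show ?case by (auto split: if_splits intro!: exI[of _ T] exI[of _ ps])
next
  case (Cons r xs)
  obtain b ms where r: "r = (b, ms)" by force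
  let ?p = "(b, map fst (filter (\<lambda>p. \<not> splits b (fst p) T T) ps))"
  have "certified (insert_point b T) (?p # ps) (xs @ (a, ls) # ys)"
    using Cons.prems(1,4) r by (auto split: if_splits)
  moreover have "sound_state (insert_point b T) (?p # ps)"
    using Cons.prems r by (intro sound_state_step) auto
  ultimately show ?case
    using Cons.IH[of "insert_point b T" "?p # ps"] Cons.prems(3,4) r by auto
qed

text \<open>
  Of two distinct vertices, one is the later; its list settles the pair.
\<close>

lemma linked_or_exchangeable:
  assumes "sound_state T ps" and "p \<in> set ps" and "q \<in> set ps" and "p \<noteq> q"
  shows "linked p q \<or> exchangeable_in (rev (map fst ps)) (fst p) (fst q)"
proof -
  have *: "exchangeable_in (rev (map fst ps)) b c"
    if "ps = us @ (b, S) # vs" "c \<in> fst ` set vs" "c \<notin> set S" for us b S vs c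
    unfolding exchangeable_in_def
  proof (intro exI conjI)
    show "rev (map fst ps) = rev (map fst vs) @ b # rev (map fst us)" using that(1) by simp
    show "exchangeable (set (rev (map fst vs))) b c"
      using assms(1) that unfolding sound_state_def by simp
    show "b = b \<and> c \<in> set (rev (map fst vs)) \<or> b = c \<and> b \<in> set (rev (map fst vs))"
      using that(2) by simp
  qed
  obtain us vs where ps: "ps = us @ p # vs" using assms(2) by (meson split_list)
  then consider "q \<in> set vs" | "q \<in> set us" using assms(3,4) by auto
  then show ?thesis
  proof cases
    case 1
    then show ?thesis using *[of us "fst p" "snd p" vs "fst q"] ps
      by (auto simp: linked_def)
  next
    case 2
    then obtain us1 us2 where "us = us1 @ q # us2" by (meson split_list)
    then show ?thesis
      using *[of us1 "fst q" "snd q" "us2 @ p # vs" "fst p"] ps exchangeable_in_commute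
      by (auto simp: linked_def)
  qed
qed

text \<open>
  By the invariant, points that are not exchangeable are linked. So \<open>W\<close> becomes a set of pairwise
  linked vertices among the ones linked to \<open>a\<close>, and the forms of the row of \<open>a\<close> cover it.
\<close>

theorem certified_sound:
  assumes certified: "certified Empty [] rs" and bin: "\<forall>r\<in>set rs. set (fst r) \<subseteq> {0, 1}"
    and distinct: "distinct (map fst rs)" and rs: "rs = xs @ (a, ls) # ys"
    and W: "W \<subseteq> fst ` set xs"
    and a: "\<And>b. b \<in> W \<Longrightarrow> \<not> exchangeable_in (map fst rs) a b"
    and pairs: "\<And>b c. b \<in> W \<Longrightarrow> c \<in> W \<Longrightarrow> b \<noteq> c \<Longrightarrow> \<not> exchangeable_in (map fst rs) b c"
  shows "\<exists>l\<in>set ls. affine l a < 0 \<and> (\<forall>b\<in>fst ` set xs. 0 \<le> affine l b) \<and> (\<forall>b\<in>W. affine l b = 0)"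
proof -
  have "sound_state Empty []" by (simp add: sound_state_def)
  from certified_reaches_row[OF certified this bin rs] obtain T ps
    where fst_ps: "map fst ps = rev (map fst xs)" and state: "sound_state T ps"
      and sep: "list_all (separating a ps) ls"
      and cov: "covered (filter (\<lambda>p. \<not> splits a (fst p) T T) ps) ls"
    by auto
  have set_ps: "fst ` set ps = fst ` set xs"
    using arg_cong[OF fst_ps, of set] by simp
  have rev_ps: "rev (map fst ps) = map fst xs" using fst_ps by simp
  have order: "map fst rs = map fst xs @ a # map fst ys" using rs by simp
  have inj: "inj_on fst (set ps)"
    using distinct order rev_ps by (metis distinct_append distinct_map distinct_rev)
  define X where "X = {p \<in> set ps. fst p \<in> W}"
  have "X \<subseteq> set (filter (\<lambda>p. \<not> splits a (fst p) T T) ps)"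
  proof
    fix p assume p: "p \<in> X"
    have "\<not> splits a (fst p) T T"
    proof
      assume "splits a (fst p) T T"
      then have "exchangeable (trie_points T) a (fst p)"
        using splits_sound[of a "fst p" T T] bin rs state p
        unfolding exchangeable_def X_def sound_state_def by auto
      then have "exchangeable (set (map fst xs)) a (fst p)"
        by (rule exchangeable_mono) (use state set_ps in \<open>auto simp: sound_state_def\<close>)
      then have "exchangeable_in (map fst rs) a (fst p)"
        unfolding exchangeable_in_def order using p W
        by (intro exI[of _ "map fst xs"] exI[of _ a] exI[of _ "map fst ys"]) (auto simp: X_def)
      then show False using a p by (auto simp: X_def)
    qed
    then show "p \<in> set (filter (\<lambda>p. \<not> splits a (fst p) T T) ps)" using p by (simp add: X_def)
  qed
  moreover have "linked p q" if "p \<in> X" "q \<in> X" "p \<noteq> q" for p q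
  proof -
    have "p \<in> set ps" "q \<in> set ps" "fst p \<in> W" "fst q \<in> W" using that by (auto simp: X_def)
    moreover from this have "fst p \<noteq> fst q" using inj that(3) by (auto dest: inj_onD)
    ultimately show ?thesis
      using linked_or_exchangeable[OF state _ _ that(3)] pairs exchangeable_in_append
      unfolding order rev_ps by blast
  qed
  ultimately obtain l where l: "l \<in> set ls" "\<forall>p\<in>X. affine l (fst p) = 0"
    using covered_sound[OF cov] by blast
  have "affine l b = 0" if "b \<in> W" for b
  proof -
    have "b \<in> fst ` set ps" using that W set_ps by blast
    then show ?thesis using l(2) that by (auto simp: X_def)
  qed
  moreover have "0 \<le> affine l b" if "b \<in> fst ` set xs" for b
    using that sep l(1) set_ps[symmetric] by (auto simp: list_all_iff separating_def)
  ultimately show ?thesis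
    using l(1) sep by (auto simp: list_all_iff separating_def)
qed

section \<open>An order of the even vectors in dimension seven\<close>

text \<open>
  The vertices of the half-cube come by increasing number of ones, the empty cut first. The
  order within each weight and the forms were found by a computer search, which built the
  placing triangulation one vertex at a time and kept a vertex only if no relation in degree three
  obstructed a quadratic basis; the forms are the facets visible from the new vertex. As long as the
  dimension still grows, a single form suffices that vanishes on all earlier vertices.
\<close>

definition table :: "(int list \<times> int list list) list" where
  "table = [
   ([0,0,0,0,0,0,0], [[-1,0,0,0,0,0,0,0]]),
   ([0,0,0,0,0,1,1], [[0,0,0,0,0,0,-1,0]]),
   ([0,0,0,1,0,1,0], [[0,0,0,0,-1,0,0,0]]),
   ([0,0,0,1,0,0,1], [[0,0,0,0,-1,0,1,-1]]),
   ([0,0,0,0,1,1,0], [[0,0,0,0,0,-1,0,0]]),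
   ([0,0,0,0,1,0,1], [[0,0,0,0,1,-1,1,-1]]),
   ([1,0,0,0,1,0,0], [[0,-1,0,0,0,0,0,0]]),
   ([0,1,0,0,0,0,1], [[0,0,-1,0,0,0,0,0]]),
   ([0,1,1,0,0,0,0], [[0,0,0,-1,0,0,0,0]]),
   ([0,1,0,0,1,0,0], [[0,1,-1,1,-1,-1,1,1]]),
   ([0,1,0,1,0,0,0], [[0,-1,-1,1,-1,1,1,1]]),
   ([0,0,1,1,0,0,0], [[0,1,1,-1,-1,-1,1,1], [0,0,1,-1,0,0,0,0]]),
   ([0,1,0,0,0,1,0], [[0,-1,-1,1,1,1,-1,1]]),
   ([0,0,1,0,0,1,0], [[0,-1,1,-1,1,1,-1,1], [0,0,1,-1,1,0,0,0]]),
   ([0,0,1,0,1,0,0], [[0,1,1,-1,1,-1,1,1]]),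
   ([1,0,0,0,0,0,1], [[0,-1,0,0,0,1,0,0], [0,-1,1,-1,1,1,1,-1]]),
   ([0,0,1,0,0,0,1], [[0,1,1,-1,1,1,1,-1]]),
   ([1,0,1,0,0,0,0], [[0,-1,0,0,0,1,0,1], [0,-1,1,-1,1,1,1,1]]),
   ([1,0,0,1,0,0,0], [[0,-1,1,1,-1,1,1,1], [0,-1,0,1,0,1,0,1]]),
   ([1,0,0,0,0,1,0], [[0,-1,1,1,1,1,-1,1]]),
   ([0,0,0,1,1,0,0], [[0,1,1,1,-1,-1,1,1]]),
   ([1,1,0,0,0,0,0], [[0,-1,-1,1,1,1,1,1]]),
   ([1,0,0,1,1,0,1], [[2,-1,-1,-1,-1,-1,-1,-1]]),
   ([1,0,1,1,1,0,0], [[2,-1,-1,-1,-1,-1,-1,1], [4,-1,-1,-3,-1,-1,-1,-1]]),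
   ([0,1,1,1,1,0,0], [[4,-1,-3,-1,-1,-1,-1,-1], [2,1,-1,-1,-1,-1,-1,-1]]),
   ([0,0,1,1,1,1,0], [[2,1,1,-1,-1,-1,-1,-1], [4,-1,-1,-1,-1,-1,-3,-1]]),
   ([0,1,0,1,1,0,1], [[2,1,-1,1,-1,-1,-1,-1], [4,1,-1,-1,-1,-1,-1,-3], [4,-1,-3,1,-1,-1,-1,-1]]),
   ([0,1,1,1,0,0,1], [[2,-1,-1,-1,-1,1,-1,-1]]),
   ([0,0,0,1,1,1,1], [[4,-1,-1,1,-1,-1,-3,-1], [3,-1,-1,0,-1,0,-2,-1], [2,1,1,1,-1,-1,-1,-1], [2,0,0,0,-1,0,-1,-1], [4,1,1,-1,-1,-1,-1,-3]]),
   ([1,0,1,0,1,1,0], [[2,-1,-1,-1,1,-1,-1,-1]]),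
   ([1,0,1,1,0,0,1], [[2,-1,1,-1,-1,1,-1,-1], [4,-3,-1,-1,-1,1,-1,-1]]),
   ([0,0,1,1,0,1,1], [[4,-1,-1,-1,-1,1,-3,-1], [2,1,1,-1,-1,1,-1,-1], [2,0,0,-1,0,0,-1,-1]]),
   ([1,0,0,0,1,1,1], [[2,-1,-1,1,1,-1,-1,-1], [2,-1,-1,0,0,0,-1,-1], [4,-1,-1,-1,1,-1,-1,-3]]),
   ([0,1,1,0,1,1,0], [[2,1,-1,-1,1,-1,-1,-1], [4,-1,-3,-1,1,-1,-1,-1]]),
   ([0,1,0,0,1,1,1], [[4,-1,-3,1,1,-1,-1,-1], [3,-1,-2,0,0,0,-1,-1], [2,1,-1,1,1,-1,-1,-1], [2,0,-1,0,0,0,-1,-1], [4,1,-1,-1,1,-1,-1,-3]]),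
   ([1,0,1,0,1,0,1], [[2,-1,-1,-1,1,-1,1,-1], [2,0,0,-1,0,-1,0,-1]]),
   ([0,1,0,1,1,1,0], [[2,-1,-1,1,-1,-1,-1,1], [2,-1,-1,0,-1,0,-1,0]]),
   ([0,1,1,0,0,1,1], [[6,-3,-3,-1,-1,1,-3,-1], [2,-1,-1,-1,1,1,-1,-1]]),
   ([0,1,1,0,1,0,1], [[4,-1,-3,-1,1,-1,1,-1], [2,1,-1,-1,1,-1,1,-1], [2,1,0,-1,0,-1,0,-1]]),
   ([1,0,1,0,0,1,1], [[12,-7,-5,-1,-3,1,-5,-1], [10,-5,-3,-1,-3,1,-5,-1], [4,-3,-1,-1,1,1,-1,-1], [2,-1,1,-1,1,1,-1,-1]]),
   ([0,0,1,1,1,0,1], [[2,1,1,-1,-1,-1,1,-1]]),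
   ([0,0,1,0,1,1,1], [[2,1,1,-1,1,-1,-1,-1]]),
   ([0,1,1,1,0,1,0], [[2,-1,-1,-1,-1,1,-1,1]]),
   ([1,0,0,1,1,1,0], [[2,-1,1,1,-1,-1,-1,1], [4,-3,-1,1,-1,-1,-1,1], [3,-2,-1,0,-1,0,-1,0], [2,-1,0,0,-1,0,-1,0]]),
   ([1,0,1,1,0,1,0], [[2,-1,1,-1,-1,1,-1,1], [4,-3,-1,-1,-1,1,-1,1]]),
   ([1,1,0,1,1,0,0], [[2,-1,-1,0,-1,0,0,0], [6,-3,-3,-1,-1,-1,-1,-1], [2,-1,-1,1,-1,-1,1,1], [2,-1,-1,0,0,-1,0,0]]),
   ([1,0,0,1,0,1,1], [[2,-1,-1,1,-1,1,-1,-1]]),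
   ([1,1,0,0,1,1,0], [[2,-1,-1,0,0,0,-1,0], [2,-1,-1,1,1,-1,-1,1], [2,-1,-1,0,1,-1,0,0], [6,-3,-3,-1,1,-1,-1,-1]]),
   ([0,1,0,1,0,1,1], [[4,-1,-3,1,-1,1,-1,-1], [2,1,-1,1,-1,1,-1,-1]]),
   ([1,1,1,0,1,0,0], [[2,-1,-1,-1,1,-1,1,1], [2,-1,-1,-1,0,0,0,0]]),
   ([1,1,0,1,0,0,1], [[6,-3,-3,-1,-1,1,-1,-1], [2,-1,-1,0,-1,1,0,0], [2,-1,-1,0,0,0,0,-1], [2,-1,-1,1,-1,1,1,-1]]),
   ([1,1,0,0,0,1,1], [[2,-1,-1,0,0,1,-1,0], [4,-2,-2,-1,0,1,-1,0], [2,-1,-1,1,1,1,-1,-1], [2,-1,-1,0,1,0,0,-1]]),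
   ([1,1,1,0,0,0,1], [[2,-1,-1,-1,0,1,0,0], [2,-1,-1,-1,1,1,1,-1]]),
   ([1,1,0,1,0,1,0], [[6,-3,-3,-1,-1,1,-1,1], [2,-1,-1,1,-1,1,-1,1]]),
   ([1,1,0,0,1,0,1], [[2,-1,-1,1,1,-1,1,-1]]),
   ([1,1,1,1,0,0,0], [[2,-1,-1,-1,-1,1,1,1]]),
   ([1,1,1,0,0,1,0], [[2,-1,-1,-1,1,1,-1,1]]),
   ([1,0,1,1,1,1,1], [[4,-1,-1,-1,-1,-1,-1,-1]]),
   ([0,1,1,1,1,1,1], [[6,-1,-3,-1,-1,-1,-1,-1], [4,1,-1,-1,-1,-1,-1,-1]]),
   ([1,1,0,1,1,1,1], [[4,-1,-1,1,-1,-1,-1,-1], [8,-3,-3,-1,-1,-1,-1,-1]]),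
   ([1,1,1,1,1,0,1], [[4,-1,-1,-1,-1,-1,1,-1], [10,-3,-3,-3,-1,-1,-1,-1]]),
   ([1,1,1,1,0,1,1], [[4,-1,-1,-1,-1,1,-1,-1]]),
   ([1,1,1,1,1,1,0], [[4,-1,-1,-1,-1,-1,-1,1]]),
   ([1,1,1,0,1,1,1], [[4,-1,-1,-1,1,-1,-1,-1]])]"

lemma table_certified: "certified Empty [] table"
  by code_simp

lemma table_format:
  "list_all (\<lambda>(a, ls). length a = 7 \<and> set a \<subseteq> {0, 1} \<and> even (sum_list a) \<and>
     list_all (\<lambda>l. length l = 8) ls) table"
  by code_simp

lemma distinct_table: "distinct (map fst table)"
  by code_simp

lemma table_complete:
  "list_all (\<lambda>a. even (sum_list a) \<longrightarrow> List.member (map fst table) a) (List.n_lists 7 [0, 1])"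
  by code_simp

lemma table_row:
  assumes "(a, ls) \<in> set table"
  shows "length a = 7" "set a \<subseteq> {0, 1}" "even (sum_list a)" "\<And>l. l \<in> set ls \<Longrightarrow> length l = 8"
  using bspec[OF table_format[unfolded list_all_iff] assms] by auto

lemma set_table: "set (map fst table) = {a. length a = 7 \<and> set a \<subseteq> {0, 1} \<and> even (sum_list a)}"
proof (intro equalityI subsetI)
  fix a assume "a \<in> set (map fst table)"
  then obtain ls where "(a, ls) \<in> set table" by auto
  from table_row(1-3)[OF this]
  show "a \<in> {a. length a = 7 \<and> set a \<subseteq> {0, 1} \<and> even (sum_list a)}" by blast
next
  fix a :: "int list" assume a: "a \<in> {a. length a = 7 \<and> set a \<subseteq> {0, 1} \<and> even (sum_list a)}"
  then have "a \<in> set (List.n_lists 7 [0, 1])" unfolding set_n_lists by simp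
  from bspec[OF table_complete[unfolded list_all_iff] this] a
  show "a \<in> set (map fst table)" by simp
qed

definition position :: "'a list \<Rightarrow> 'a \<Rightarrow> nat" where
  "position xs x = length (takeWhile (\<lambda>y. y \<noteq> x) xs)"

lemma position_eq: "xs = us @ z # vs \<Longrightarrow> distinct xs \<Longrightarrow> position xs z = length us"
proof -
  assume xs: "xs = us @ z # vs" "distinct xs"
  then have "\<forall>y\<in>set us. y \<noteq> z" by auto
  then show ?thesis unfolding position_def xs(1) by (subst takeWhile_append2) auto
qed

lemma position_less_iff:
  assumes "distinct xs" and "xs = us @ z # vs" and "x \<in> set xs"
  shows "position xs x < position xs z \<longleftrightarrow> x \<in> set us"
proof -
  have z: "position xs z = length us" by (rule position_eq[OF assms(2,1)])
  consider "x \<in> set us" | "x = z" | "x \<in> set vs" using assms(2,3) by auto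
  then show ?thesis
  proof cases
    case 1
    then obtain u1 u2 where "us = u1 @ x # u2" by (meson split_list)
    then show ?thesis using position_eq[of xs u1 x "u2 @ z # vs"] assms z 1 by auto
  next
    case 2
    then show ?thesis using assms by auto
  next
    case 3
    then obtain v1 v2 where "vs = v1 @ x # v2" by (meson split_list)
    then show ?thesis using position_eq[of xs "us @ z # v1" x v2] assms z 3 by auto
  qed
qed

lemma inj_on_position: "inj_on (position xs) (set xs)"
proof (rule inj_on_inverseI)
  fix x assume "x \<in> set xs"
  then obtain us vs where xs: "xs = us @ x # vs" and "x \<notin> set us" by (meson split_list_first)
  then have "position xs x = length us"
    unfolding position_def xs by (subst takeWhile_append2) auto
  then show "xs ! position xs x = x" unfolding xs by simp
qed

definition padded :: "nat \<Rightarrow> int vec \<Rightarrow> int list" where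
  "padded m v = map (\<lambda>t. if t < m then v $ t else 0) [0..<7]"

lemma sum_list_padded:
  assumes "m \<le> 7" shows "sum_list (padded m v) = (\<Sum>t<m. v $ t)"
proof -
  have "sum_list (padded m v) = (\<Sum>t<7. if t < m then v $ t else 0)"
    by (simp add: padded_def sum_list_distinct_conv_sum_set atLeast0LessThan)
  also have "\<dots> = (\<Sum>t<m. v $ t)"
    using assms by (intro sum.mono_neutral_cong_right) auto
  finally show ?thesis .
qed

lemma padded_in_table:
  assumes "m \<le> 7" and "v \<in> even_vectors m"
  shows "padded m v \<in> set (map fst table)"
proof -
  have "length (padded m v) = 7" by (simp add: padded_def)
  moreover have "set (padded m v) \<subseteq> {0, 1}"
    using assms(2) unfolding padded_def even_vectors_def by auto
  moreover have "even (sum_list (padded m v))"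
    unfolding sum_list_padded[OF assms(1)] using assms(2) unfolding even_vectors_def by blast
  ultimately show ?thesis unfolding set_table by blast
qed

text \<open>
  This recognizes the points that replace an exchangeable pair of padded vectors as padded vectors.
\<close>

lemma padded_surj:
  assumes m: "m \<le> 7" and c: "c \<in> set (map fst table)" and zero: "\<And>t. m \<le> t \<Longrightarrow> t < 7 \<Longrightarrow> c ! t = 0"
  shows "vec m ((!) c) \<in> even_vectors m" and "padded m (vec m ((!) c)) = c"
proof -
  have c': "length c = 7" "set c \<subseteq> {0, 1}" "even (sum_list c)" using c unfolding set_table by auto
  show eq: "padded m (vec m ((!) c)) = c"
    by (rule nth_equalityI) (use c' zero in \<open>auto simp: padded_def\<close>)
  have "even (\<Sum>t<m. vec m ((!) c) $ t)"
    using sum_list_padded[OF m, of "vec m ((!) c)"] c'(3) unfolding eq by simp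
  moreover have "c ! t \<in> {0, 1}" if "t < m" for t
  proof -
    have "c ! t \<in> set c" using that m c'(1) by (intro nth_mem) simp
    then show ?thesis using c'(2) by blast
  qed
  ultimately show "vec m ((!) c) \<in> even_vectors m" by (simp add: even_vectors_def)
qed

lemma dot_eq_sum:
  "length ks = length xs \<Longrightarrow> set xs \<subseteq> {0, 1} \<Longrightarrow> dot ks xs = (\<Sum>t<length xs. ks ! t * xs ! t)"
proof (induction ks xs rule: list_induct2)
  case (Cons k ks x xs)
  then have "dot (k # ks) (x # xs) = k * x + (\<Sum>t<length xs. ks ! t * xs ! t)" by auto
  also have "\<dots> = (\<Sum>t<length (x # xs). (k # ks) ! t * (x # xs) ! t)"
    unfolding list.size(4) add_Suc_right add_0_right sum.lessThan_Suc_shift by simp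
  finally show ?case .
qed simp

lemma affine_padded:
  assumes "m \<le> 7" and "v \<in> even_vectors m" and "length l = 8"
  shows "affine l (padded m v) = l ! 0 + (\<Sum>t<m. l ! Suc t * v $ t)"
proof -
  obtain k ks where l: "l = k # ks" "length ks = 7" using assms(3) by (cases l) auto
  have "set (padded m v) \<subseteq> {0, 1}" "length (padded m v) = 7"
    using assms(2) by (auto simp: padded_def even_vectors_def)
  then have "dot ks (padded m v) = (\<Sum>t<7. ks ! t * padded m v ! t)"
    using dot_eq_sum[of ks "padded m v"] l(2) by simp
  also have "\<dots> = (\<Sum>t<m. ks ! t * v $ t)"
    using assms(1) by (intro sum.mono_neutral_cong_right) (auto simp: padded_def)
  finally show ?thesis by (simp add: l(1))
qed

section \<open>Cut ideals of cycles of length at most seven\<close>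

theorem theorem2p3:
  fixes m :: nat and E :: "nat set set" and es :: "nat set list" and ds :: "int vec list"
  assumes "is_cycle m E" and "m \<le> 7"
    and "edge_enumeration E es" and "cut_enumeration m es ds"
  shows "\<exists>r (B :: 'k::field mpoly set).
    linear_order_on {..<length ds} r \<and>
    lex_groebner_basis (length ds) r (cut_ideal es ds) B \<and>
    (\<forall>g \<in> B. quadratic_binomial g)"
proof -
  define A where "A = cut_matrix es ds"
  define order where "order = map fst table"
  define pt where "pt j = padded m (ds ! j)" for j
  define \<rho> where "\<rho> j = position order (pt j)" for j
  have len: "length es = m" and ds: "set ds = even_vectors m" and "distinct ds"
    using cut_vectors_of_cycle[OF assms(1,3)] assms(4) by (auto simp: cut_enumeration_def)
  have dims: "dim_col A = length ds" "dim_row A = Suc m"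
    by (simp_all add: A_def cut_matrix_def len)
  have entry: "A $$ (k, j) = (if k < m then ds ! j $ k else 1)" if "k < Suc m" "j < length ds" for k j
    using that by (simp add: A_def cut_matrix_def len)
  have even: "ds ! j \<in> even_vectors m" if "j < length ds" for j using that ds nth_mem by blast
  have pt_order: "pt j \<in> set order" if "j < length ds" for j
    unfolding pt_def order_def by (rule padded_in_table[OF assms(2) even[OF that]])
  have pt_nth: "pt j ! t = (if t < m then ds ! j $ t else 0)" if "t < 7" for j t
    using that by (simp add: pt_def padded_def)
  have "distinct order" unfolding order_def by (rule distinct_table)
  have pt_inj: "j = k" if "j < length ds" "k < length ds" "pt j = pt k" for j k
  proof -
    have "ds ! j = ds ! k"
    proof (rule eq_vecI)
      show "dim_vec (ds ! j) = dim_vec (ds ! k)"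
        using even[OF that(1)] even[OF that(2)] by (simp add: even_vectors_def)
      fix t assume "t < dim_vec (ds ! k)"
      then have "t < m" using even[OF that(2)] by (simp add: even_vectors_def)
      then show "ds ! j $ t = ds ! k $ t"
        using pt_nth[of t j] pt_nth[of t k] that(3) assms(2) by simp
    qed
    then show ?thesis using \<open>distinct ds\<close> that by (simp add: nth_eq_iff_index_eq)
  qed
  have inj: "inj_on \<rho> {..<length ds}"
    using inj_on_position[of order] pt_order pt_inj
    by (auto simp: inj_on_def \<rho>_def)
  have exchangeable_columns: "exchangeable_columns A \<rho> i j"
    if "i < length ds" "j < length ds" and ij: "exchangeable_in order (pt i) (pt j)" for i j
  proof -
    obtain us z vs c d where z: "order = us @ z # vs" "z = pt i \<or> z = pt j"
      and c: "c \<in> set us" and d: "d \<in> set us" and sum: "map2 (+) c d = map2 (+) (pt i) (pt j)"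
      using ij unfolding exchangeable_in_def exchangeable_def by blast
    have in_order: "c \<in> set order" "d \<in> set order" using c d z(1) by auto
    then have "length c = 7" "length d = 7" "set c \<subseteq> {0, 1}" "set d \<subseteq> {0, 1}"
      unfolding order_def set_table by auto
    have "length (pt i) = 7" "length (pt j) = 7" by (simp_all add: pt_def padded_def)
    have nth_sum: "c ! t + d ! t = pt i ! t + pt j ! t" if "t < 7" for t
      using arg_cong[OF sum, of "\<lambda>xs. xs ! t"] that \<open>length c = 7\<close> \<open>length d = 7\<close>
        \<open>length (pt i) = 7\<close> \<open>length (pt j) = 7\<close> by simp
    have bits: "c ! t \<in> {0, 1}" "d ! t \<in> {0, 1}" if "t < 7" for t
      using that nth_mem[of t c] nth_mem[of t d] \<open>set c \<subseteq> {0, 1}\<close> \<open>set d \<subseteq> {0, 1}\<close>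
      unfolding \<open>length c = 7\<close> \<open>length d = 7\<close> by blast+
    \<comment> \<open>The points of the face \<open>x\<^sub>t = 0\<close> for \<open>t \<ge> m\<close> are exchanged only for points of this face.\<close>
    have zero: "c ! t = 0 \<and> d ! t = 0" if "m \<le> t" "t < 7" for t
      using nth_sum[OF that(2)] bits[OF that(2)] that by (auto simp: pt_nth)
    have "\<exists>k<length ds. pt k = x" if "x \<in> set order" "\<And>t. m \<le> t \<Longrightarrow> t < 7 \<Longrightarrow> x ! t = 0" for x
    proof -
      have "vec m ((!) x) \<in> set ds" "padded m (vec m ((!) x)) = x"
        using padded_surj[OF assms(2) that(1)[unfolded order_def] that(2)] ds by auto
      then show ?thesis unfolding pt_def by (metis in_set_conv_nth)
    qed
    then obtain k l where k: "k < length ds" "pt k = c" and l: "l < length ds" "pt l = d"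
      using in_order zero by metis
    have "position order z \<le> max (\<rho> i) (\<rho> j)" using z(2) by (auto simp: \<rho>_def)
    moreover have "\<rho> k < position order z" "\<rho> l < position order z"
      using position_less_iff[OF \<open>distinct order\<close> z(1)] c d in_order k(2) l(2) by (auto simp: \<rho>_def)
    moreover have "A $$ (n, i) + A $$ (n, j) = A $$ (n, k) + A $$ (n, l)" if n: "n < Suc m" for n
    proof (cases "n < m")
      case True
      then have "n < 7" using assms(2) by simp
      then show ?thesis
        using nth_sum[of n] True n k l \<open>i < length ds\<close> \<open>j < length ds\<close> by (auto simp: entry pt_nth)
    next
      case False
      then show ?thesis using n k(1) l(1) that \<open>i < length ds\<close> \<open>j < length ds\<close> by (simp add: entry)
    qed
    ultimately show ?thesis
      unfolding exchangeable_columns_def dims using k(1) l(1) by (meson less_le_trans)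
  qed
  have visible_face: "visible_face A \<rho> i W"
    if i: "i < dim_col A" and W: "W \<subseteq> {j. j < dim_col A \<and> \<rho> j < \<rho> i}"
      and i_W: "\<And>j. j \<in> W \<Longrightarrow> \<not> exchangeable_columns A \<rho> i j"
      and W_W: "\<And>j k. j \<in> W \<Longrightarrow> k \<in> W \<Longrightarrow> j \<noteq> k \<Longrightarrow> \<not> exchangeable_columns A \<rho> j k" for i W
  proof -
    have i': "i < length ds" using i dims by simp
    obtain us vs where "order = us @ pt i # vs" using pt_order[OF i'] by (meson split_list)
    then obtain xs ls ys where table: "table = xs @ (pt i, ls) # ys"
      unfolding order_def by (auto simp: map_eq_append_conv)
    have order: "order = map fst xs @ pt i # map fst ys" unfolding order_def table by simp
    have earlier: "pt j \<in> fst ` set xs" if "j < length ds" "\<rho> j < \<rho> i" for j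
      using position_less_iff[OF \<open>distinct order\<close> order pt_order[OF that(1)]] that(2)
      by (simp add: \<rho>_def)
    have W': "j < length ds" "\<rho> j < \<rho> i" if "j \<in> W" for j using W that dims by auto
    have "\<exists>l\<in>set ls. affine l (pt i) < 0 \<and> (\<forall>b\<in>fst ` set xs. 0 \<le> affine l b) \<and>
        (\<forall>b\<in>pt ` W. affine l b = 0)"
    proof (rule certified_sound[OF table_certified _ distinct_table table])
      show "\<forall>r\<in>set table. set (fst r) \<subseteq> {0, 1}"
        using table_row(2) by force
      show "pt ` W \<subseteq> fst ` set xs" using earlier W' by blast
      show "\<not> exchangeable_in (map fst table) (pt i) b" if "b \<in> pt ` W" for b
        using exchangeable_columns i_W W' i' that unfolding order_def by blast
      show "\<not> exchangeable_in (map fst table) b c" if "b \<in> pt ` W" "c \<in> pt ` W" "b \<noteq> c" for b c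
        using exchangeable_columns W_W W' that unfolding order_def by blast
    qed
    then obtain l where l: "l \<in> set ls" "affine l (pt i) < 0" "\<forall>b\<in>fst ` set xs. 0 \<le> affine l b"
      "\<forall>b\<in>pt ` W. affine l b = 0" by blast
    have "(pt i, ls) \<in> set table" by (subst table) simp
    then have "length l = 8" using table_row(4) l(1) by blast
    \<comment> \<open>The last row of the matrix consists of ones and takes up the constant term of the form.\<close>
    define y where "y k = (if k < m then l ! Suc k else l ! 0)" for k
    have on_column: "linear_form A y j = affine l (pt j)" if "j < length ds" for j
      unfolding pt_def affine_padded[OF assms(2) even[OF that] \<open>length l = 8\<close>] linear_form_def dims
      using that by (simp add: entry y_def)
    have "0 \<le> affine l (pt j)" if "j < length ds" "\<rho> j < \<rho> i" for j
      using l(3) earlier[OF that] by blast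
    then show ?thesis unfolding visible_face_def dims
      by (intro exI[of _ y]) (use l(2,4) on_column W' i' in auto)
  qed
  obtain B :: "'k mpoly set" where
    "lex_groebner_basis (dim_col A) (rank_rel (dim_col A) \<rho>) (toric_ideal A) B"
    "\<forall>g\<in>B. quadratic_binomial g"
    using quadratic_lex_groebner_basis_if_visible_faces[of \<rho> A] inj visible_face unfolding dims by blast
  then show ?thesis
    using linear_order_rank_rel[OF inj] unfolding cut_ideal_def A_def[symmetric] dims by blast
qed
end
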